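(* Assume $\dim\mathfrak X<\infty$. Let $\{V_n:n\in\mathbb N\}$ be a sequence of $\mathcal P_{kc}(\mathfrak X)$-valued random variables which are uncorrelated and compactly uniformly integrable in $L^2$, and suppose that for every $x^*\in S^*$, $$\frac{1}{n^2}\sum_{k=1}^{n}\mathrm{Var}(\sigma(x^*,V_k))\longrightarrow 0\quad\text{as } n\to\infty.$$ Then for every $\varepsilon>0$, $$P\Big\{d_H\Big(\frac1n\sum_{k=1}^n V_k,\ \frac1n\sum_{k=1}^n E[V_k]\Big)>\varepsilon\Big\}\longrightarrow 0\quad\text{as } n\to\infty.$$
   Context: $(\Omega,\mathcal A,\mu)$ is a complete, non-atomic probability space; $P$ denotes $\mu$, and $E$, $\mathrm{Var}$, $\mathrm{cov}$ are taken with respect to it. $(\mathfrak X,\|\cdot\|)$ is a real separable Banach space with dual $(\mathfrak X^*,\|\cdot\|_{\mathfrak X^*})$, and $S^*$ is the unit sphere of $\mathfrak X^*$. $\mathcal P_k(\mathfrak X)$ (resp. $\mathcal P_{kc}(\mathfrak X)$) is the family of nonempty compact (resp. compact convex) subsets of $\mathfrak X$. $A+B=\{a+b:a\in A,b\in B\}$, $\lambda A=\{\lambda a:a\in A\}$; sums of sets are Minkowski sums. The Hausdorff metric is $d_H(A,B)=\max\{\sup_{a\in A}\inf_{b\in B}\|a-b\|,\ \sup_{b\in B}\inf_{a\in A}\|a-b\|\}$, and $\|A\|_{\mathcal P}=d_H(\{0\},A)=\sup_{a\in A}\|a\|$. The support function is $\sigma(x^*,A)=\sup_{a\in A}\langle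 x^*,a\rangle$, $x^*\in\mathfrak X^*$. A set-valued random variable is a map $F$ from $\Omega$ to the nonempty closed subsets of $\mathfrak X$ with $\{\omega:F(\omega)\cap O\neq\emptyset\}\in\mathcal A$ for every open $O\subset\mathfrak X$; it is $\mathcal P_{kc}(\mathfrak X)$-valued if all its values lie in $\mathcal P_{kc}(\mathfrak X)$. Its expectation is the Aumann integral $E[F]=\{E[f]:f\in S_F\}$, where $S_F$ is the set of Bochner integrable $f:\Omega\to\mathfrak X$ with $f(\omega)\in F(\omega)$ a.s. Real random variables $\xi,\eta$ are uncorrelated if $\mathrm{cov}(\xi,\eta)=0$. A sequence of set-valued random variables $\{F_1,F_2,\dots\}$ is (pairwise) uncorrelated if for every $x^*\in\mathfrak X^*$ the real random variables $\sigma(x^*,F_1),\sigma(x^*,F_2),\dots$ are pairwise uncorrelated. A sequence $\{F_n\}$ of $\mathcal P_k(\mathfrak X)$-valued random variables is compactly uniformly integrable in $L^p$ ($p\ge1$) if for each $\epsilon>0$ there is a compact subset $\mathcal K_\epsilon$ of the metric space $(\mathcal P_k(\mathfrak X),d_H)$ such that $E\big[\|F_n\|_{\mathcal P}^p\, I_{\{F_n\notin\mathcal K_\epsilon\}}\big]<\epsilon$ for all $n$, where $I$ is the indicator function. *)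

theory Defs
  imports "HOL-Probability.Probability"
begin

definition nonatomic :: "'w measure \<Rightarrow> bool" where
  "nonatomic M \<longleftrightarrow>
     (\<forall>A\<in>sets M. 0 < emeasure M A \<longrightarrow>
        (\<exists>B\<in>sets M. B \<subseteq> A \<and> 0 < emeasure M B \<and> emeasure M B < emeasure M A))"


section \<open>Compact sets and the Hausdorff metric\<close>

definition Pk :: "'a::metric_space set set" where
  "Pk = {A. A \<noteq> {} \<and> compact A}"

definition Pkc :: "'a::real_normed_vector set set" where
  "Pkc = {A. A \<noteq> {} \<and> compact A \<and> convex A}"

text \<open>
  The suprema here and in \<open>support_fun\<close> below are suprema of reals, hence meaningful for
  nonempty bounded sets. This covers the members of \<open>Pk\<close>.
\<close>

definition hausdorff_dist :: "'a::metric_space set \<Rightarrow> 'a set \<Rightarrow> real" where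
  "hausdorff_dist A B = max (SUP a\<in>A. infdist a B) (SUP b\<in>B. infdist b A)"

definition set_norm :: "'a::real_normed_vector set \<Rightarrow> real" where
  "set_norm A = hausdorff_dist {0} A"

definition support_fun :: "('a::real_normed_vector \<Rightarrow>\<^sub>L real) \<Rightarrow> 'a set \<Rightarrow> real" where
  "support_fun x A = (SUP a\<in>A. blinfun_apply x a)"

lemma bdd_above_infdist_Pk:
  assumes "A \<in> Pk"
  shows "bdd_above ((\<lambda>a. infdist a B) ` A)"
proof -
  have "compact ((\<lambda>a. infdist a B) ` A)"
    using assms by (intro compact_continuous_image continuous_intros) (auto simp: Pk_def)
  then show ?thesis
    by (intro bounded_imp_bdd_above compact_imp_bounded)
qed

lemma hausdorff_dist_le_iff:
  assumes "A \<in> Pk" "B \<in> Pk"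
  shows "hausdorff_dist A B \<le> r \<longleftrightarrow>
           (\<forall>a\<in>A. infdist a B \<le> r) \<and> (\<forall>b\<in>B. infdist b A \<le> r)"
  using assms bdd_above_infdist_Pk[of A B] bdd_above_infdist_Pk[of B A]
  by (simp add: hausdorff_dist_def cSUP_le_iff Pk_def)

lemma hausdorff_dist_commute: "hausdorff_dist A B = hausdorff_dist B A"
  by (simp add: hausdorff_dist_def max.commute)

lemma infdist_le_hausdorff_dist:
  "A \<in> Pk \<Longrightarrow> B \<in> Pk \<Longrightarrow> a \<in> A \<Longrightarrow> infdist a B \<le> hausdorff_dist A B"
  using hausdorff_dist_le_iff by blast

lemma hausdorff_dist_nonneg:
  assumes "A \<in> Pk" "B \<in> Pk"
  shows "0 \<le> hausdorff_dist A B"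
proof -
  obtain a where "a \<in> A"
    using assms by (auto simp: Pk_def)
  then show ?thesis
    using infdist_le_hausdorff_dist[OF assms] infdist_nonneg order_trans by blast
qed

lemma hausdorff_dist_eq_0_iff:
  assumes "A \<in> Pk" "B \<in> Pk"
  shows "hausdorff_dist A B = 0 \<longleftrightarrow> A = B"
proof -
  have cl: "closed A" "closed B" "A \<noteq> {}" "B \<noteq> {}"
    using assms by (auto simp: Pk_def compact_imp_closed)
  have "hausdorff_dist A B = 0 \<longleftrightarrow> hausdorff_dist A B \<le> 0"
    using hausdorff_dist_nonneg[OF assms] by auto
  also have "\<dots> \<longleftrightarrow> (\<forall>a\<in>A. infdist a B = 0) \<and> (\<forall>b\<in>B. infdist b A = 0)"
    unfolding hausdorff_dist_le_iff[OF assms] by (simp add: order_antisym_conv infdist_nonneg)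
  also have "\<dots> \<longleftrightarrow> A = B"
    using cl by (auto simp: in_closed_iff_infdist_zero[symmetric])
  finally show ?thesis .
qed

lemma infdist_triangle_hausdorff_dist:
  assumes "A \<in> Pk" "B \<in> Pk" "C \<in> Pk" "a \<in> A"
  shows "infdist a C \<le> hausdorff_dist A B + hausdorff_dist B C"
proof -
  have "continuous_on B (dist a)"
    by (intro continuous_intros)
  then obtain b where b: "b \<in> B" "\<forall>y\<in>B. dist a b \<le> dist a y"
    using assms continuous_attains_inf[of B "dist a"] by (auto simp: Pk_def)
  then have ab: "dist a b \<le> infdist a B"
    by (auto simp: infdist_def intro: cINF_greatest)
  have "infdist a C \<le> infdist b C + dist a b"
    by (rule infdist_triangle)
  then show ?thesis
    using ab b assms infdist_le_hausdorff_dist[of A B a] infdist_le_hausdorff_dist[of B C b] by auto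
qed

lemma hausdorff_dist_triangle:
  assumes "A \<in> Pk" "B \<in> Pk" "C \<in> Pk"
  shows "hausdorff_dist A C \<le> hausdorff_dist A B + hausdorff_dist B C"
  using infdist_triangle_hausdorff_dist[of A B C] infdist_triangle_hausdorff_dist[of C B A] assms
  by (auto simp: hausdorff_dist_le_iff hausdorff_dist_commute[of B A]
        hausdorff_dist_commute[of C B] add.commute)

text \<open>
  The locale \<^locale>\<open>Metric_space\<close> demands a function that is nonnegative also outside the
  carrier, so the Hausdorff distance is cut off there.
\<close>

definition Pk_dist :: "'a::metric_space set \<Rightarrow> 'a set \<Rightarrow> real" where
  "Pk_dist A B = (if A \<in> Pk \<and> B \<in> Pk then hausdorff_dist A B else 0)"

lemma Metric_space_Pk: "Metric_space Pk Pk_dist"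
  by standard
    (auto simp: Pk_dist_def hausdorff_dist_nonneg hausdorff_dist_commute
      hausdorff_dist_eq_0_iff hausdorff_dist_triangle)

definition Pk_topology :: "'a::metric_space set topology" where
  "Pk_topology = Metric_space.mtopology Pk Pk_dist"

lemma set_norm_eq:
  assumes "A \<in> Pk"
  shows "set_norm A = (SUP a\<in>A. norm a)"
proof -
  have ne: "A \<noteq> {}"
    using assms by (simp add: Pk_def)
  then obtain a where a: "a \<in> A" by auto
  have eq: "infdist b {0} = norm b" for b :: 'a
    by (simp add: infdist_def)
  have "infdist 0 A \<le> norm a"
    using infdist_le[OF a, of 0] by simp
  also have "norm a \<le> (SUP a\<in>A. norm a)"
    using bdd_above_infdist_Pk[OF assms, of "{0}"] a by (intro cSUP_upper) (simp_all add: eq)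
  finally show ?thesis
    by (simp add: set_norm_def hausdorff_dist_def eq)
qed


section \<open>Set-valued random variables\<close>

definition set_valued_rv :: "'w measure \<Rightarrow> ('w \<Rightarrow> 'a::real_normed_vector set) \<Rightarrow> bool" where
  "set_valued_rv M F \<longleftrightarrow>
     (\<forall>\<omega>\<in>space M. F \<omega> \<noteq> {} \<and> closed (F \<omega>)) \<and>
     (\<forall>U. open U \<longrightarrow> {\<omega>\<in>space M. F \<omega> \<inter> U \<noteq> {}} \<in> sets M)"

definition Pkc_valued_rv :: "'w measure \<Rightarrow> ('w \<Rightarrow> 'a::real_normed_vector set) \<Rightarrow> bool" where
  "Pkc_valued_rv M F \<longleftrightarrow> set_valued_rv M F \<and> (\<forall>\<omega>\<in>space M. F \<omega> \<in> Pkc)"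

definition aumann_integral ::
    "'w measure \<Rightarrow> ('w \<Rightarrow> 'a::{banach, second_countable_topology} set) \<Rightarrow> 'a set" where
  "aumann_integral M F =
     {integral\<^sup>L M f | f. integrable M f \<and> (AE \<omega> in M. f \<omega> \<in> F \<omega>)}"

definition cov :: "'w measure \<Rightarrow> ('w \<Rightarrow> real) \<Rightarrow> ('w \<Rightarrow> real) \<Rightarrow> real" where
  "cov M \<xi> \<eta> =
     integral\<^sup>L M (\<lambda>\<omega>. (\<xi> \<omega> - integral\<^sup>L M \<xi>) * (\<eta> \<omega> - integral\<^sup>L M \<eta>))"

text \<open>
  Integrals of nonintegrable functions are \<open>0\<close>, so the existence of the covariance
  has to be stated along with its vanishing.
\<close>

definition uncorrelated :: "'w measure \<Rightarrow> ('w \<Rightarrow> real) \<Rightarrow> ('w \<Rightarrow> real) \<Rightarrow> bool" where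
  "uncorrelated M \<xi> \<eta> \<longleftrightarrow>
     integrable M \<xi> \<and> integrable M \<eta> \<and> integrable M (\<lambda>\<omega>. \<xi> \<omega> * \<eta> \<omega>) \<and> cov M \<xi> \<eta> = 0"

text \<open>
  Sequences are indexed from \<open>0\<close>, so the sum of the first \<open>n\<close> members runs over \<open>k < n\<close>.
\<close>

definition uncorrelated_seq ::
    "'w measure \<Rightarrow> (nat \<Rightarrow> 'w \<Rightarrow> 'a::real_normed_vector set) \<Rightarrow> bool" where
  "uncorrelated_seq M F \<longleftrightarrow>
     (\<forall>x :: 'a \<Rightarrow>\<^sub>L real. \<forall>i j. i \<noteq> j \<longrightarrow>
        uncorrelated M (\<lambda>\<omega>. support_fun x (F i \<omega>)) (\<lambda>\<omega>. support_fun x (F j \<omega>)))"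

definition compactly_uniformly_integrable ::
    "real \<Rightarrow> 'w measure \<Rightarrow> (nat \<Rightarrow> 'w \<Rightarrow> 'a::real_normed_vector set) \<Rightarrow> bool" where
  "compactly_uniformly_integrable p M F \<longleftrightarrow>
     (\<forall>\<epsilon>>0. \<exists>K. compactin Pk_topology K \<and>
        (\<forall>n. (\<integral>\<^sup>+\<omega>. ennreal (set_norm (F n \<omega>) powr p) * indicator {\<omega>. F n \<omega> \<notin> K} \<omega> \<partial>M)
               < ennreal \<epsilon>))"

end

theory Submission
  imports Defs
begin

text \<open>
  By duality, the Hausdorff distance of two convex sets is controlled by the difference of their
  support functions on the dual unit ball. For a fixed functional, the averages of the support
  functions satisfy the weak law by Chebyshev's argument, and the expected support functions
  belong to the Aumann integrals because a measurable selection can maximise a prescribed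
  functional. Compact uniform integrability bounds the second moments of the norms uniformly,
  so the averaged support functions are Lipschitz with constants bounded in mean; a finite net
  of the compact dual ball then makes the convergence uniform. Only the convexity of the Aumann
  integrals is needed: their closures have the same distances to points.
\<close>

section \<open>Finite-dimensional normed spaces\<close>

text \<open>The obstacle is uniformity: Chebyshev's argument handles one functional at a time,
  whereas the Hausdorff distance involves all functionals of norm at most 1. Working in mean
  resolves this. On the net, the expected absolute deviations are finitely many null sequences. Off
  the net, the error is the mesh times an average of norms plus a constant, whose mean is bounded
  independently of \<open>n\<close>. The net can therefore be fixed before \<open>n\<close> grows,
  and a single Markov inequality finishes the argument. The norm is arbitrary and finite dimension
  is given only as a finite spanning set, so the analysis starts from the continuity of coordinates.
  The measurable selection is lexicographic: the prescribed functional is maximised first, then the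
  coordinate functionals one after another. This leaves exactly one point, whose coordinates are
  values of support functions of iterated faces, and these are limits of difference quotients of
  support functions.\<close>

lemma compact_image_coefficient_box:
  fixes v :: "'i \<Rightarrow> 'a::real_normed_vector"
  assumes "finite I"
  shows "compact {\<Sum>i\<in>I. c i *\<^sub>R v i | c. \<forall>i\<in>I. \<bar>c i\<bar> \<le> r}"
  using assms
proof (induction I)
  case empty
  then show ?case by simp
next
  case (insert j I)
  let ?S = "{\<Sum>i\<in>I. c i *\<^sub>R v i | c. \<forall>i\<in>I. \<bar>c i\<bar> \<le> r}"
  \<comment> \<open>The new axis contributes the segment \<open>?L\<close>. Adding it as a Minkowski
    sum preserves compactness without putting a topology on coefficient functions.\<close>
  let ?L = "(\<lambda>t. t *\<^sub>R v j) ` {-r..r}"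
  have "compact ?L"
    by (intro compact_continuous_image continuous_intros) auto
  then have "compact {x + y |x y. x \<in> ?L \<and> y \<in> ?S}"
    using insert by (intro compact_sums)
  also have "{x + y |x y. x \<in> ?L \<and> y \<in> ?S}
      = {\<Sum>i\<in>insert j I. c i *\<^sub>R v i | c. \<forall>i\<in>insert j I. \<bar>c i\<bar> \<le> r}" (is "?P = ?Q")
  proof
    show "?P \<subseteq> ?Q"
    proof
      fix z assume "z \<in> ?P"
      then obtain t c where "\<bar>t\<bar> \<le> r" "\<forall>i\<in>I. \<bar>c i\<bar> \<le> r" and z: "z = t *\<^sub>R v j + (\<Sum>i\<in>I. c i *\<^sub>R v i)"
        by (force simp: abs_le_iff)
      moreover have "(\<Sum>i\<in>I. c i *\<^sub>R v i) = (\<Sum>i\<in>I. (c(j := t)) i *\<^sub>R v i)"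
        using insert by (intro sum.cong) auto
      ultimately show "z \<in> ?Q"
        using insert by (intro CollectI exI[of _ "c(j := t)"]) auto
    qed
    show "?Q \<subseteq> ?P"
      using insert by (fastforce simp: abs_le_iff)
  qed
  finally show ?case .
qed

text \<open>Combinations with coefficient 1 at \<open>b\<close> and all others in [-1, 1] form a
  compact set that misses 0 by independence, so their norms have a positive lower bound. Dividing a
  vector by its largest coefficient brings it into this form.\<close>

lemma representation_bound:
  fixes B :: "'a::real_normed_vector set"
  assumes "finite B" "independent B" "span B = UNIV"
  obtains K where "K > 0" "\<And>y b. \<bar>representation B y b\<bar> \<le> K * norm y"
proof -
  have "\<exists>m>0. \<forall>c. c b = 1 \<and> (\<forall>i\<in>B. \<bar>c i\<bar> \<le> 1) \<longrightarrow> m \<le> norm (\<Sum>i\<in>B. c i *\<^sub>R i)"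
    if b: "b \<in> B" for b
  proof -
    define S where "S = (\<lambda>x. b + x) ` {\<Sum>i\<in>B-{b}. c i *\<^sub>R i | c. \<forall>i\<in>B-{b}. \<bar>c i\<bar> \<le> 1}"
    have nz: "b + (\<Sum>i\<in>B-{b}. c i *\<^sub>R i) \<noteq> 0" for c
    proof
      assume "b + (\<Sum>i\<in>B-{b}. c i *\<^sub>R i) = 0"
      then have "b = - (\<Sum>i\<in>B-{b}. c i *\<^sub>R i)"
        by (simp add: eq_neg_iff_add_eq_0)
      also have "\<dots> \<in> span (B - {b})"
        by (intro span_neg span_sum span_scale span_base) auto
      finally show False
        using assms b by (auto simp: dependent_def)
    qed
    have cl: "closed S"
      unfolding S_def
      by (intro compact_imp_closed compact_continuous_image compact_image_coefficient_box
          continuous_intros) (use assms in auto)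
    have "0 \<in> - S"
      using nz by (force simp: S_def)
    moreover have "open (- S)"
      using cl by (rule open_Compl)
    ultimately obtain m where "m > 0" "ball 0 m \<subseteq> - S"
      unfolding open_contains_ball by blast
    then have m: "m > 0" "\<And>x. x \<in> S \<Longrightarrow> m \<le> dist 0 x"
      by (auto simp: subset_iff not_less)
    show ?thesis
    proof (intro exI[of _ m] conjI m(1) allI impI)
      fix c :: "'a \<Rightarrow> real" assume c: "c b = 1 \<and> (\<forall>i\<in>B. \<bar>c i\<bar> \<le> 1)"
      have "(\<Sum>i\<in>B. c i *\<^sub>R i) = b + (\<Sum>i\<in>B-{b}. c i *\<^sub>R i)"
        using assms b c by (simp add: sum.remove)
      also have "\<dots> \<in> S"
        using c by (auto simp: S_def)
      finally show "m \<le> norm (\<Sum>i\<in>B. c i *\<^sub>R i)"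
        using m(2) by (metis dist_0_norm)
    qed
  qed
  then obtain m where m: "\<And>b. b \<in> B \<Longrightarrow> m b > 0"
      "\<And>b c. b \<in> B \<Longrightarrow> c b = 1 \<Longrightarrow> \<forall>i\<in>B. \<bar>c i\<bar> \<le> 1 \<Longrightarrow> m b \<le> norm (\<Sum>i\<in>B. c i *\<^sub>R i)"
    by metis
  \<comment> \<open>The largest coefficient may sit at any basis vector, so the reciprocals of all
    lower bounds are added up; the summand 1 keeps \<open>K\<close> positive for an empty
    basis.\<close>
  define K where "K = 1 + (\<Sum>b\<in>B. 1 / m b)"
  have s: "0 \<le> (\<Sum>b\<in>B. 1 / m b)"
    using m(1) by (intro sum_nonneg) (auto simp: less_imp_le)
  have "\<bar>representation B y b\<bar> \<le> K * norm y" for y b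
  proof (cases "representation B y b = 0")
    case True
    then show ?thesis using s by (simp add: K_def)
  next
    case False
    define c where "c = representation B y"
    have y: "y = (\<Sum>i\<in>B. c i *\<^sub>R i)"
      using assms by (simp add: c_def sum_representation_eq)
    have bB: "b \<in> B"
      using False representation_ne_zero by blast
    then have "Max ((\<lambda>i. \<bar>c i\<bar>) ` B) \<in> (\<lambda>i. \<bar>c i\<bar>) ` B"
      using \<open>finite B\<close> by (intro Max_in) auto
    then obtain d where d0: "d \<in> B" "Max ((\<lambda>i. \<bar>c i\<bar>) ` B) = \<bar>c d\<bar>"
      by auto
    have d: "d \<in> B" "\<forall>i\<in>B. \<bar>c i\<bar> \<le> \<bar>c d\<bar>"
      using d0(1) \<open>finite B\<close> unfolding d0(2)[symmetric] by (auto intro: Max_ge)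
    have cd: "c d \<noteq> 0"
      using d bB False by (force simp: c_def)
    have "m d \<le> norm (\<Sum>i\<in>B. (c i / c d) *\<^sub>R i)"
      using d cd by (intro m(2)) (auto simp: divide_simps)
    also have "(\<Sum>i\<in>B. (c i / c d) *\<^sub>R i) = (1 / c d) *\<^sub>R y"
      by (simp add: y scaleR_sum_right)
    finally have "m d \<le> norm y / \<bar>c d\<bar>"
      by simp
    then have "\<bar>c d\<bar> \<le> (1 / m d) * norm y"
      using cd m(1)[OF d(1)] by (simp add: field_simps)
    also have "1 / m d \<le> K"
      using member_le_sum[of d B "\<lambda>b. 1 / m b"] d assms m(1) by (force simp: K_def less_imp_le)
    finally have "\<bar>c d\<bar> \<le> K * norm y"
      by (simp add: mult_right_mono)
    then show ?thesis
      using d bB by (force simp: c_def)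
  qed
  with s show ?thesis
    by (intro that[of K]) (auto simp: K_def)
qed

text \<open>Thinning the spanning set to an independent one makes coordinates unique and hence
  linear; the bound on coordinates makes them continuous.\<close>

lemma finite_dim_coordinates:
  assumes "\<exists>B :: 'a::real_normed_vector set. finite B \<and> span B = UNIV"
  obtains B :: "'a::real_normed_vector set" and e :: "'a \<Rightarrow> 'a \<Rightarrow>\<^sub>L real"
  where "finite B" "span B = UNIV" "\<And>y. y = (\<Sum>b\<in>B. blinfun_apply (e b) y *\<^sub>R b)"
proof -
  obtain B0 :: "'a set" where B0: "finite B0" "span B0 = UNIV"
    using assms by blast
  obtain B where B: "B \<subseteq> B0" "independent B" "B0 \<subseteq> span B"
    by (rule maximal_independent_subset)
  have fin: "finite B"
    using B0 B finite_subset by blast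
  have sp: "span B = UNIV"
    using B0 B by (metis span_mono span_span top.extremum_uniqueI)
  obtain K where K: "K > 0" "\<And>y b. \<bar>representation B y b\<bar> \<le> K * norm y"
    using representation_bound[OF fin B(2) sp] by metis
  have bl: "bounded_linear (\<lambda>y. representation B y b)" for b
    by (rule bounded_linear_intro[of _ K])
      (use B sp K in \<open>auto simp: representation_add representation_scale mult.commute\<close>)
  show ?thesis
  proof (rule that[of B "\<lambda>b. Blinfun (\<lambda>y. representation B y b)"])
    show "y = (\<Sum>b\<in>B. blinfun_apply (Blinfun (\<lambda>y. representation B y b)) y *\<^sub>R b)" for y
      using B sp fin by (simp add: bounded_linear_Blinfun_apply[OF bl] sum_representation_eq)
  qed (use fin sp in auto)
qed

text \<open>In the coordinate functionals \<open>e b\<close>, a functional \<open>x\<close> has the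
  coefficients \<open>x b\<close>. For norm at most 1 these are bounded by \<open>norm b\<close>, so
  the ball is a closed part of a compact coefficient box.\<close>

lemma compact_dual_cball:
  assumes "\<exists>B :: 'a::real_normed_vector set. finite B \<and> span B = UNIV"
  shows "compact (cball (0 :: 'a::real_normed_vector \<Rightarrow>\<^sub>L real) 1)"
proof -
  obtain B :: "'a set" and e :: "'a \<Rightarrow> 'a \<Rightarrow>\<^sub>L real"
    where B: "finite B" "\<And>y. y = (\<Sum>b\<in>B. blinfun_apply (e b) y *\<^sub>R b)"
    using finite_dim_coordinates[OF assms] by metis
  define r where "r = (\<Sum>b\<in>B. norm b)"
  let ?S = "{\<Sum>b\<in>B. c b *\<^sub>R e b | c. \<forall>b\<in>B. \<bar>c b\<bar> \<le> r}"
  have "x \<in> ?S" if x: "norm x \<le> 1" for x :: "'a \<Rightarrow>\<^sub>L real"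
  proof -
    have "x = (\<Sum>b\<in>B. blinfun_apply x b *\<^sub>R e b)"
    proof (rule blinfun_eqI)
      fix y
      have "blinfun_apply x y = (\<Sum>b\<in>B. blinfun_apply (e b) y * blinfun_apply x b)"
        by (subst (1) B(2)[of y]) (simp add: blinfun.bilinear_simps blinfun.sum_right)
      then show "blinfun_apply x y = blinfun_apply (\<Sum>b\<in>B. blinfun_apply x b *\<^sub>R e b) y"
        by (simp add: blinfun.bilinear_simps blinfun.sum_left mult.commute)
    qed
    moreover have "\<bar>blinfun_apply x b\<bar> \<le> r" if "b \<in> B" for b
    proof -
      have "\<bar>blinfun_apply x b\<bar> \<le> norm x * norm b"
        using norm_blinfun[of x b] by simp
      also have "\<dots> \<le> norm b"
        using x by (simp add: mult_left_le_one_le)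
      also have "\<dots> \<le> r"
        unfolding r_def using that B by (intro member_le_sum) auto
      finally show ?thesis .
    qed
    ultimately show ?thesis
      by blast
  qed
  then have "cball 0 1 = ?S \<inter> cball 0 1"
    by auto
  moreover have "compact (?S \<inter> cball 0 1)"
    by (rule compact_Int_closed[OF compact_image_coefficient_box[OF B(1)] closed_cball])
  ultimately show ?thesis
    by (rule ssubst)
qed

lemma finite_dual_net:
  assumes "\<exists>B :: 'a::real_normed_vector set. finite B \<and> span B = UNIV" and "\<delta> > 0"
  obtains N :: "('a::real_normed_vector \<Rightarrow>\<^sub>L real) set"
  where "finite N" "\<And>x. norm x \<le> 1 \<Longrightarrow> \<exists>z\<in>N. norm (x - z) \<le> \<delta>"
proof -
  obtain N where N: "finite N" "cball (0 :: 'a \<Rightarrow>\<^sub>L real) 1 \<subseteq> (\<Union>z\<in>N. ball z \<delta>)"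
    using compact_dual_cball[OF assms(1)] \<open>\<delta> > 0\<close> unfolding compact_eq_totally_bounded by metis
  show ?thesis
  proof (rule that[OF N(1)])
    fix x :: "'a \<Rightarrow>\<^sub>L real" assume "norm x \<le> 1"
    then obtain z where "z \<in> N" "x \<in> ball z \<delta>"
      using N(2) by auto
    then show "\<exists>z\<in>N. norm (x - z) \<le> \<delta>"
      by (auto simp: dist_norm norm_minus_commute intro!: bexI[of _ z])
  qed
qed

section \<open>Sublinear functionals and separation\<close>

text \<open>The one-sided scaling condition forces equality for \<open>t > 0\<close>, by applying it
  to \<open>1 / t\<close>; hence a newly built functional only has inequalities to satisfy.\<close>

definition sublinear :: "('a::real_vector \<Rightarrow> real) \<Rightarrow> bool" where
  "sublinear p \<longleftrightarrow> (\<forall>x y. p (x + y) \<le> p x + p y) \<and> (\<forall>x t. t > 0 \<longrightarrow> p (t *\<^sub>R x) \<le> t * p x)"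

lemma sublinear_add: "sublinear p \<Longrightarrow> p (x + y) \<le> p x + p y"
  by (simp add: sublinear_def)

lemma sublinear_scale:
  assumes "sublinear p" "t > 0"
  shows "p (t *\<^sub>R x) = t * p x"
proof (rule antisym)
  show "p (t *\<^sub>R x) \<le> t * p x"
    using assms by (simp add: sublinear_def)
  have "p ((1 / t) *\<^sub>R (t *\<^sub>R x)) \<le> (1 / t) * p (t *\<^sub>R x)"
    using assms unfolding sublinear_def by (metis zero_less_divide_1_iff)
  then show "t * p x \<le> p (t *\<^sub>R x)"
    using assms(2) by (simp add: field_simps)
qed

lemma sublinear_0: "sublinear p \<Longrightarrow> p 0 = 0"
  using sublinear_scale[of p 2 0] by simp

lemma sublinear_uminus: "sublinear p \<Longrightarrow> - p (- x) \<le> p x"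
  using sublinear_add[of p x "- x"] sublinear_0[of p] by simp

text \<open>Both the separation of a point from a convex set and the one-dimensional steps of the
  Hahn-Banach theorem are instances of the following infimal convolution with a cone.\<close>

lemma sublinear_cone_minorant:
  fixes p :: "'a::real_vector \<Rightarrow> real" and C :: "('a \<times> real) set"
  assumes p: "sublinear p"
    and C0: "(0, 0) \<in> C"
    and add: "\<And>u v. u \<in> C \<Longrightarrow> v \<in> C \<Longrightarrow> u + v \<in> C"
    and scale: "\<And>u t. u \<in> C \<Longrightarrow> t > 0 \<Longrightarrow> t *\<^sub>R u \<in> C"
    and le: "\<And>c r. (c, r) \<in> C \<Longrightarrow> r \<le> p c"
  obtains q where "sublinear q" "\<And>x. q x \<le> p x" "\<And>c r. (c, r) \<in> C \<Longrightarrow> q (- c) \<le> - r"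
proof -
  define g where "g x u = p (x + fst u) - snd u" for x and u :: "'a \<times> real"
  define q where "q x = (INF u\<in>C. g x u)" for x
  \<comment> \<open>Subadditivity and \<open>r \<le> p c\<close> on the cone keep the infimum
    finite.\<close>
  have "- p (- x) \<le> g x u" if "u \<in> C" for x u
    using sublinear_add[OF p, of "x + fst u" "- x"] le[of "fst u" "snd u"] that
    by (auto simp: g_def)
  then have bdd: "bdd_below (g x ` C)" for x
    by (intro bdd_belowI2)
  have q_le: "q x \<le> g x u" if "u \<in> C" for x u
    unfolding q_def using bdd that by (rule cINF_lower)
  have ge_q: "a \<le> q x" if "\<And>u. u \<in> C \<Longrightarrow> a \<le> g x u" for a x
    unfolding q_def using C0 that by (intro cINF_greatest) auto
  have "q (x + y) \<le> q x + q y" for x y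
  proof -
    have "q (x + y) - g y v \<le> g x u" if "u \<in> C" "v \<in> C" for u v
      using q_le[OF add[OF that], of "x + y"] sublinear_add[OF p, of "x + fst u" "y + fst v"]
      by (simp add: g_def algebra_simps)
    then have "q (x + y) - g y v \<le> q x" if "v \<in> C" for v
      using that by (intro ge_q)
    then have "q (x + y) - q x \<le> q y"
      by (intro ge_q) (auto simp: algebra_simps)
    then show ?thesis by simp
  qed
  moreover have "q (t *\<^sub>R x) \<le> t * q x" if "t > 0" for x t
  proof -
    have "q (t *\<^sub>R x) / t \<le> g x u" if "u \<in> C" for u
    proof -
      have "q (t *\<^sub>R x) \<le> p (t *\<^sub>R (x + fst u)) - t * snd u"
        using q_le[OF scale[OF that \<open>t > 0\<close>], of "t *\<^sub>R x"] by (simp add: g_def scaleR_add_right)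
      also have "\<dots> = t * g x u"
        by (simp only: sublinear_scale[OF p \<open>t > 0\<close>] g_def right_diff_distrib)
      finally show ?thesis
        using \<open>t > 0\<close> by (simp add: field_simps)
    qed
    then have "q (t *\<^sub>R x) / t \<le> q x"
      by (rule ge_q)
    then show ?thesis
      using \<open>t > 0\<close> by (simp add: field_simps)
  qed
  moreover have "q x \<le> p x" for x
    using q_le[OF C0, of x] by (simp add: g_def)
  moreover have "q (- c) \<le> - r" if "(c, r) \<in> C" for c r
    using q_le[OF that, of "- c"] sublinear_0[OF p] by (simp add: g_def)
  ultimately show ?thesis
    using that by (metis sublinear_def)
qed

text \<open>Convolving with the ray through \<open>(b, q b)\<close> gives a minorant
  \<open>s\<close> with \<open>s (- b) \<le> - q b \<le> - s b\<close>. The reverse inequality holds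
  for every sublinear functional, so \<open>s\<close> is odd at \<open>b\<close>. Oddness gained
  earlier survives the passage to a smaller functional for the same reason.\<close>

lemma sublinear_odd_on_finite_set:
  assumes "finite B" "sublinear p"
  obtains q where "sublinear q" "\<And>x. q x \<le> p x" "\<And>b. b \<in> B \<Longrightarrow> q (- b) = - q b"
proof -
  have "\<exists>q. sublinear q \<and> (\<forall>x. q x \<le> p x) \<and> (\<forall>b\<in>B. q (- b) = - q b)"
    using assms
  proof (induction B)
    case empty
    then show ?case by auto
  next
    case (insert b B)
    then obtain q where q: "sublinear q" "\<And>x. q x \<le> p x" "\<And>b. b \<in> B \<Longrightarrow> q (- b) = - q b"
      by auto
    let ?C = "(\<lambda>t. t *\<^sub>R (b, q b)) ` {0..}"
    obtain s where s: "sublinear s" "\<And>x. s x \<le> q x" "\<And>c r. (c, r) \<in> ?C \<Longrightarrow> s (- c) \<le> - r"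
    proof (rule sublinear_cone_minorant[OF q(1), of ?C])
      show "(0, 0) \<in> ?C"
        by (rule image_eqI[of _ _ 0]) auto
      show "u + v \<in> ?C" if uv: "u \<in> ?C" "v \<in> ?C" for u v
      proof -
        obtain t t' where "u = t *\<^sub>R (b, q b)" "v = t' *\<^sub>R (b, q b)" "t \<ge> 0" "t' \<ge> 0"
          using uv by auto
        then show ?thesis
          by (intro image_eqI[of _ _ "t + t'"]) (auto simp: algebra_simps)
      qed
      show "t *\<^sub>R u \<in> ?C" if "u \<in> ?C" "t > 0" for u t
        using that by (force simp: image_iff)
      show "r \<le> q c" if cr: "(c, r) \<in> ?C" for c r
      proof -
        obtain t where t: "t \<ge> 0" "c = t *\<^sub>R b" "r = t * q b"
          using cr by auto
        then show ?thesis
          using sublinear_scale[OF q(1), of t b] sublinear_0[OF q(1)] by (cases "t = 0") auto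
      qed
    qed blast
    have "(b, q b) \<in> ?C"
      by (rule image_eqI[of _ _ 1]) auto
    then have sb: "s (- b) \<le> - q b"
      by (rule s(3))
    have odd: "s (- c) = - s c" if "s (- c) \<le> - q c" for c
      using that s(2)[of c] sublinear_uminus[OF s(1), of c] by linarith
    have "s (- c) = - s c" if "c \<in> insert b B" for c
      using that sb s(2)[of "- c"] q(3)[of c] by (intro odd) auto
    then show ?case
      using s(1,2) q(2) order_trans by blast
  qed
  then show ?thesis
    using that by blast
qed

text \<open>The points at which a sublinear functional is odd form a subspace, so oddness spreads
  from a spanning set to the whole space; a sublinear functional that is odd everywhere is
  linear.\<close>

lemma hahn_banach_finite_dim:
  fixes p :: "'a::real_vector \<Rightarrow> real"
  assumes "\<exists>B :: 'a set. finite B \<and> span B = UNIV" "sublinear p"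
  obtains f where "linear f" "\<And>x. f x \<le> p x"
proof -
  obtain B :: "'a set" where B: "finite B" "span B = UNIV"
    using assms by blast
  obtain q where q: "sublinear q" "\<And>x. q x \<le> p x" "\<And>b. b \<in> B \<Longrightarrow> q (- b) = - q b"
    using sublinear_odd_on_finite_set[OF B(1) assms(2)] by metis
  have odd_add: "q (- (x + y)) = - q (x + y)" if "q (- x) = - q x" "q (- y) = - q y" for x y
    using sublinear_add[OF q(1), of x y] sublinear_add[OF q(1), of "- x" "- y"]
      sublinear_uminus[OF q(1), of "x + y"] that by simp
  have scale: "q (t *\<^sub>R x) = t * q x" if "q (- x) = - q x" for x t
  proof (cases t "0 :: real" rule: linorder_cases)
    case less
    then show ?thesis
      using sublinear_scale[OF q(1), of "- t" "- x"] that by simp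
  qed (use sublinear_scale[OF q(1)] sublinear_0[OF q(1)] in auto)
  have "subspace {x. q (- x) = - q x}"
  proof (rule subspaceI)
    show "0 \<in> {x. q (- x) = - q x}"
      using sublinear_0[OF q(1)] by simp
  next
    fix x y assume "x \<in> {x. q (- x) = - q x}" "y \<in> {x. q (- x) = - q x}"
    then show "x + y \<in> {x. q (- x) = - q x}"
      using odd_add by simp
  next
    fix t x assume "x \<in> {x. q (- x) = - q x}"
    then show "t *\<^sub>R x \<in> {x. q (- x) = - q x}"
      using scale[of x t] scale[of x "- t"] by simp
  qed
  then have odd: "q (- x) = - q x" for x
    using span_minimal[of B "{x. q (- x) = - q x}"] q(3) B(2) by auto
  have "q (x + y) = q x + q y" for x y
    using sublinear_add[OF q(1), of x y] sublinear_add[OF q(1), of "- x" "- y"] odd[of x] odd[of y]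
      odd[of "x + y"] by simp
  then have "linear q"
    using scale odd by (intro linearI) auto
  then show ?thesis
    using q(2) that by blast
qed

text \<open>The cone generated by the pairs \<open>(b - a, infdist b A)\<close> lies below the norm
  because \<open>infdist b A \<le> dist b a\<close>, and convexity of \<open>A\<close> makes it
  closed under addition. A linear minorant of the norm adapted to this cone is at least
  \<open>infdist b A\<close> on every \<open>b - a\<close>.\<close>

lemma dual_norm_attained_infdist:
  fixes A :: "'a::real_normed_vector set"
  assumes fd: "\<exists>B :: 'a set. finite B \<and> span B = UNIV" and "convex A" "A \<noteq> {}"
  obtains x :: "'a \<Rightarrow>\<^sub>L real"
  where "norm x \<le> 1" "\<And>a. a \<in> A \<Longrightarrow> infdist b A \<le> blinfun_apply x b - blinfun_apply x a"
proof -
  let ?d = "infdist b A"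
  let ?C = "{t *\<^sub>R (b - a, ?d) | t a. t \<ge> 0 \<and> a \<in> A}"
  have norm: "sublinear (norm :: 'a \<Rightarrow> real)"
    by (simp add: sublinear_def norm_triangle_ineq)
  obtain q where q: "sublinear q" "\<And>x. q x \<le> norm x" "\<And>c r. (c, r) \<in> ?C \<Longrightarrow> q (- c) \<le> - r"
  proof (rule sublinear_cone_minorant[OF norm, of ?C])
    show "(0, 0) \<in> ?C"
      using \<open>A \<noteq> {}\<close> by force
    show "u + v \<in> ?C" if uv: "u \<in> ?C" "v \<in> ?C" for u v
    proof -
      obtain t a t' a' where u: "u = t *\<^sub>R (b - a, ?d)" "t \<ge> 0" "a \<in> A"
        and v: "v = t' *\<^sub>R (b - a', ?d)" "t' \<ge> 0" "a' \<in> A"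
        using uv by blast
      show ?thesis
      proof (cases "t + t' = 0")
        case True
        then have "t = 0" "t' = 0"
          using u v by auto
        then show ?thesis
          using u v by auto
      next
        case False
        \<comment> \<open>Normalising the weights makes the sum of two generators
          \<open>t + t'\<close> times a single generator.\<close>
        let ?a = "(t / (t + t')) *\<^sub>R a + (t' / (t + t')) *\<^sub>R a'"
        have "?a \<in> A"
          using \<open>convex A\<close> u v False
          by (intro convexD) (auto simp: add_divide_distrib[symmetric])
        moreover have "(t + t') *\<^sub>R ?a = t *\<^sub>R a + t' *\<^sub>R a'"
          using False by (simp add: scaleR_add_right)
        then have "(t + t') *\<^sub>R (b - ?a) = t *\<^sub>R (b - a) + t' *\<^sub>R (b - a')"
          by (simp only: scaleR_diff_right) (simp add: scaleR_add_left)
        ultimately show ?thesis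
          using u v by (intro CollectI exI[of _ "t + t'"] exI[of _ ?a]) (auto simp: distrib_right)
      qed
    qed
    show "t *\<^sub>R u \<in> ?C" if ut: "u \<in> ?C" "t > 0" for u t
    proof -
      obtain s a where "u = s *\<^sub>R (b - a, ?d)" "s \<ge> 0" "a \<in> A"
        using ut by blast
      then show ?thesis
        using ut by (intro CollectI exI[of _ "t * s"] exI[of _ a]) auto
    qed
    show "r \<le> norm c" if cr: "(c, r) \<in> ?C" for c r
    proof -
      obtain t a where t: "c = t *\<^sub>R (b - a)" "r = t * ?d" "t \<ge> 0" "a \<in> A"
        using cr by auto
      then show ?thesis
        using infdist_le[of a A b] by (simp add: dist_norm mult_left_mono)
    qed
  qed blast
  obtain f where f: "linear f" "\<And>x. f x \<le> q x"
    using hahn_banach_finite_dim[OF fd q(1)] by metis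
  have abs_f: "\<bar>f y\<bar> \<le> norm y" for y
    using f(2)[of y] f(2)[of "- y"] q(2)[of y] q(2)[of "- y"] linear_neg[OF f(1), of y] by auto
  have bl: "bounded_linear f"
    using f(1) abs_f by (intro bounded_linear_intro[of _ 1]) (auto simp: linear_add linear_scale)
  show ?thesis
  proof (rule that[of "Blinfun f"])
    show "norm (Blinfun f) \<le> 1"
      using abs_f by (intro norm_blinfun_bound) (auto simp: bounded_linear_Blinfun_apply[OF bl])
    fix a assume "a \<in> A"
    then have "(b - a, ?d) \<in> ?C"
      by (intro CollectI exI[of _ 1] exI[of _ a]) auto
    then have "f (- (b - a)) \<le> - ?d"
      using q(3) f(2) order_trans by blast
    then show "?d \<le> blinfun_apply (Blinfun f) b - blinfun_apply (Blinfun f) a"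
      using f(1) by (simp add: bounded_linear_Blinfun_apply[OF bl] linear_diff)
  qed
qed

section \<open>Support functions and extremal selections\<close>

lemma PkD: "A \<in> Pk \<Longrightarrow> compact A" "A \<in> Pk \<Longrightarrow> A \<noteq> {}"
  by (auto simp: Pk_def)

lemma bdd_above_blinfun_Pk:
  fixes x :: "'a::real_normed_vector \<Rightarrow>\<^sub>L real"
  assumes "A \<in> Pk"
  shows "bdd_above (blinfun_apply x ` A)"
  using assms by (intro bounded_imp_bdd_above compact_imp_bounded compact_continuous_image
      linear_continuous_on blinfun.bounded_linear_right) (auto simp: Pk_def)

lemma blinfun_le_support_fun:
  "A \<in> Pk \<Longrightarrow> a \<in> A \<Longrightarrow> blinfun_apply x a \<le> support_fun x A"
  unfolding support_fun_def by (intro cSUP_upper bdd_above_blinfun_Pk)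

lemma support_fun_least:
  "A \<in> Pk \<Longrightarrow> (\<And>a. a \<in> A \<Longrightarrow> blinfun_apply x a \<le> r) \<Longrightarrow> support_fun x A \<le> r"
  unfolding support_fun_def by (intro cSUP_least) (auto dest: PkD)

lemma support_fun_attained:
  assumes "A \<in> Pk"
  obtains a where "a \<in> A" "blinfun_apply x a = support_fun x A"
proof -
  obtain a where a: "a \<in> A" "\<forall>b\<in>A. blinfun_apply x b \<le> blinfun_apply x a"
    using continuous_attains_sup[of A "blinfun_apply x"] PkD[OF assms]
    by (meson blinfun.bounded_linear_right linear_continuous_on)
  then have "support_fun x A \<le> blinfun_apply x a"
    using assms by (intro support_fun_least) auto
  then show ?thesis
    using a blinfun_le_support_fun[OF assms a(1), of x] by (intro that[of a]) auto
qed

lemma norm_le_set_norm: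
  assumes "A \<in> Pk" "a \<in> A"
  shows "norm a \<le> set_norm A"
proof -
  have "bdd_above (norm ` A)"
    using assms by (intro bounded_imp_bdd_above compact_imp_bounded compact_continuous_image
      continuous_intros) (auto simp: Pk_def)
  then show ?thesis
    unfolding set_norm_eq[OF assms(1)] using assms(2) by (rule cSUP_upper2) auto
qed

lemma set_norm_nonneg: "A \<in> Pk \<Longrightarrow> 0 \<le> set_norm A"
  using norm_le_set_norm norm_ge_zero order_trans PkD(2) by (metis ex_in_conv)

text \<open>This carries estimates from a finite net to the whole dual ball; with
  \<open>z = 0\<close> it also bounds the support function by
  \<open>norm x * set_norm A\<close>.\<close>

lemma support_fun_diff_le:
  assumes "A \<in> Pk"
  shows "\<bar>support_fun x A - support_fun z A\<bar> \<le> norm (x - z) * set_norm A"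
proof -
  have "support_fun x A \<le> support_fun z A + norm (x - z) * set_norm A"
    for x z
  proof (rule support_fun_least[OF assms])
    fix a assume a: "a \<in> A"
    have "blinfun_apply x a = blinfun_apply z a + blinfun_apply (x - z) a"
      by (simp add: blinfun.diff_left)
    moreover have "blinfun_apply (x - z) a \<le> norm (x - z) * norm a"
      using norm_blinfun[of "x - z" a] by simp
    moreover have "norm (x - z) * norm a \<le> norm (x - z) * set_norm A"
      using norm_le_set_norm[OF assms a] by (intro mult_left_mono) auto
    ultimately show "blinfun_apply x a \<le> support_fun z A + norm (x - z) * set_norm A"
      using blinfun_le_support_fun[OF assms a, of z] by linarith
  qed
  from this[of x z] this[of z x] show ?thesis
    by (simp add: norm_minus_commute abs_le_iff)
qed

lemma support_fun_zero: "A \<in> Pk \<Longrightarrow> support_fun 0 A = 0"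
  by (auto simp: support_fun_def Pk_def)

lemma support_fun_scaleR:
  assumes "A \<in> Pk" "t \<ge> 0"
  shows "support_fun (t *\<^sub>R x) A = t * support_fun x A"
proof (rule antisym)
  show "support_fun (t *\<^sub>R x) A \<le> t * support_fun x A"
    using assms by (intro support_fun_least)
      (auto simp: blinfun.scaleR_left blinfun_le_support_fun mult_left_mono)
  obtain a where "a \<in> A" "blinfun_apply x a = support_fun x A"
    using support_fun_attained[OF assms(1)] by metis
  then show "t * support_fun x A \<le> support_fun (t *\<^sub>R x) A"
    using blinfun_le_support_fun[OF assms(1), of a "t *\<^sub>R x"] by (simp add: blinfun.scaleR_left)
qed

text \<open>The exposed face of \<open>A\<close> in the direction \<open>x\<close>.\<close>

definition face :: "('a::real_normed_vector \<Rightarrow>\<^sub>L real) \<Rightarrow> 'a set \<Rightarrow> 'a set" where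
  "face x A = {a \<in> A. blinfun_apply x a = support_fun x A}"

lemma face_subset: "face x A \<subseteq> A"
  by (auto simp: face_def)

lemma face_Pk:
  assumes "A \<in> Pk"
  shows "face x A \<in> Pk"
proof -
  have "closed {a. blinfun_apply x a = support_fun x A}"
    by (intro closed_Collect_eq continuous_intros)
  then have "compact (A \<inter> {a. blinfun_apply x a = support_fun x A})"
    using PkD[OF assms] by (intro compact_Int_closed)
  moreover have "A \<inter> {a. blinfun_apply x a = support_fun x A} = face x A"
    by (auto simp: face_def)
  moreover have "face x A \<noteq> {}"
    using support_fun_attained[OF assms, of x] by (auto simp: face_def)
  ultimately show ?thesis
    by (simp add: Pk_def)
qed

text \<open>The support function of a face is the directional derivative of the support function;
  this is why passing to a face preserves measurability.\<close>

lemma support_fun_face_limit: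
  assumes A: "A \<in> Pk"
  shows "(\<lambda>n. real (Suc n) * (support_fun (x + (1 / real (Suc n)) *\<^sub>R y) A - support_fun x A))
           \<longlonglongrightarrow> support_fun y (face x A)"
proof (rule order_tendstoI)
  let ?g = "\<lambda>n. real (Suc n) * (support_fun (x + (1 / real (Suc n)) *\<^sub>R y) A - support_fun x A)"
  have F: "face x A \<in> Pk"
    using A by (rule face_Pk)
  have "support_fun y (face x A) \<le> ?g n" for n
  proof (rule support_fun_least[OF F])
    fix a assume "a \<in> face x A"
    then have "a \<in> A" "blinfun_apply x a = support_fun x A"
      by (auto simp: face_def)
    then have "support_fun x A + blinfun_apply y a / real (Suc n)
        \<le> support_fun (x + (1 / real (Suc n)) *\<^sub>R y) A"
      using blinfun_le_support_fun[OF A, of a "x + (1 / real (Suc n)) *\<^sub>R y"]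
      by (simp add: blinfun.add_left blinfun.scaleR_left)
    then show "blinfun_apply y a \<le> ?g n"
      by (simp add: field_simps del: of_nat_Suc)
  qed
  then show "\<forall>\<^sub>F n in sequentially. r < ?g n" if "r < support_fun y (face x A)" for r
    using that by (auto intro!: always_eventually intro: less_le_trans)
  fix r assume "support_fun y (face x A) < r"
  then obtain s where s: "support_fun y (face x A) < s" "s < r"
    using dense by blast
  \<comment> \<open>Points whose \<open>y\<close>-value is at least \<open>s\<close> lie off the
    face. By compactness their \<open>x\<close>-values stay below the maximum by a uniform gap
    \<open>\<eta>\<close>, and \<open>C\<close> bounds what they can gain in \<open>y\<close> over
    \<open>s\<close>.\<close>
  let ?A' = "A \<inter> {a. s \<le> blinfun_apply y a}"
  define C where "C = \<bar>s\<bar> + \<bar>support_fun y A\<bar>"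
  have "\<exists>\<eta>>0. \<forall>a\<in>?A'. blinfun_apply x a \<le> support_fun x A - \<eta>"
  proof (cases "?A' = {}")
    case False
    have "closed {a. s \<le> blinfun_apply y a}"
      by (intro closed_Collect_le continuous_intros)
    then have "?A' \<in> Pk"
      using PkD[OF A] False by (auto simp: Pk_def intro: compact_Int_closed)
    then obtain a where a: "a \<in> ?A'" "blinfun_apply x a = support_fun x ?A'"
      using support_fun_attained by metis
    have "blinfun_apply x a \<noteq> support_fun x A"
      using a blinfun_le_support_fun[OF F, of a y] s by (auto simp: face_def)
    then have "blinfun_apply x a < support_fun x A"
      using a blinfun_le_support_fun[OF A, of a x] by auto
    then show ?thesis
      using a blinfun_le_support_fun[OF \<open>?A' \<in> Pk\<close>, of _ x]
      by (intro exI[of _ "support_fun x A - blinfun_apply x a"]) auto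
  qed (auto intro: exI[of _ 1])
  then obtain \<eta> where \<eta>: "\<eta> > 0" "\<And>a. a \<in> ?A' \<Longrightarrow> blinfun_apply x a \<le> support_fun x A - \<eta>"
    by blast
  \<comment> \<open>From here on the loss in \<open>x\<close>, magnified by \<open>Suc n\<close>,
    outweighs any gain in \<open>y\<close>.\<close>
  have "\<forall>\<^sub>F n in sequentially. C < real (Suc n) * \<eta>"
    using \<eta>(1) by real_asymp
  then show "\<forall>\<^sub>F n in sequentially. ?g n < r"
  proof eventually_elim
    case (elim n)
    have "support_fun (x + (1 / real (Suc n)) *\<^sub>R y) A \<le> support_fun x A + s / real (Suc n)"
    proof (rule support_fun_least[OF A])
      fix a assume a: "a \<in> A"
      have "real (Suc n) * blinfun_apply x a + blinfun_apply y a
          \<le> real (Suc n) * support_fun x A + s"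
      proof (cases "a \<in> ?A'")
        case True
        have "real (Suc n) * blinfun_apply x a \<le> real (Suc n) * (support_fun x A - \<eta>)"
          using \<eta>(2)[OF True] by (intro mult_left_mono) auto
        moreover have "blinfun_apply y a - s \<le> C"
          using blinfun_le_support_fun[OF A a, of y] by (simp add: C_def)
        ultimately show ?thesis
          using elim by (simp add: right_diff_distrib del: of_nat_Suc)
      next
        case False
        then have "blinfun_apply y a \<le> s"
          using a by auto
        moreover have "real (Suc n) * blinfun_apply x a \<le> real (Suc n) * support_fun x A"
          using blinfun_le_support_fun[OF A a, of x] by (intro mult_left_mono) auto
        ultimately show ?thesis
          by linarith
      qed
      then have "real (Suc n) * blinfun_apply (x + (1 / real (Suc n)) *\<^sub>R y) a
          \<le> real (Suc n) * (support_fun x A + s / real (Suc n))"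
        by (simp add: blinfun.add_left blinfun.scaleR_left distrib_left del: of_nat_Suc)
      then show "blinfun_apply (x + (1 / real (Suc n)) *\<^sub>R y) a \<le> support_fun x A + s / real (Suc n)"
        by (simp del: of_nat_Suc)
    qed
    then have "?g n \<le> s"
      by (simp add: field_simps del: of_nat_Suc)
    then show ?case
      using s by simp
  qed
qed

text \<open>Measurability is expressed through support functions instead of hit sets because this
  form passes to faces by pointwise limits and is immediate when the support functions are
  integrable.\<close>

definition support_measurable ::
    "'w measure \<Rightarrow> ('w \<Rightarrow> 'a::real_normed_vector set) \<Rightarrow> bool" where
  "support_measurable M F \<longleftrightarrow> (\<forall>\<omega>\<in>space M. F \<omega> \<in> Pk) \<and>
     (\<forall>x. (\<lambda>\<omega>. support_fun x (F \<omega>)) \<in> borel_measurable M)"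

lemma support_measurable_face:
  assumes "support_measurable M F"
  shows "support_measurable M (\<lambda>\<omega>. face x (F \<omega>))"
  unfolding support_measurable_def
proof (intro conjI ballI allI)
  fix y
  have [measurable]: "(\<lambda>\<omega>. support_fun x (F \<omega>)) \<in> borel_measurable M" for x
    using assms by (simp add: support_measurable_def)
  show "(\<lambda>\<omega>. support_fun y (face x (F \<omega>))) \<in> borel_measurable M"
  proof (rule borel_measurable_LIMSEQ_real)
    show "(\<lambda>n. real (Suc n) * (support_fun (x + (1 / real (Suc n)) *\<^sub>R y) (F \<omega>)
        - support_fun x (F \<omega>))) \<longlonglongrightarrow> support_fun y (face x (F \<omega>))" if "\<omega> \<in> space M" for \<omega>
      using assms that by (intro support_fun_face_limit) (auto simp: support_measurable_def)
  qed measurable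
qed (use assms in \<open>auto simp: support_measurable_def face_Pk\<close>)

text \<open>Taking the face in a direction makes that functional constant, and further faces are
  subsets, so constancy is never lost. Over a system of coordinates this singles out a lexicographic
  maximiser.\<close>

lemma support_measurable_iterated_face:
  fixes F :: "'w \<Rightarrow> 'a::real_normed_vector set" and X :: "('a \<Rightarrow>\<^sub>L real) set"
  assumes "finite X" "support_measurable M F"
  obtains G where "support_measurable M G" "\<And>\<omega>. G \<omega> \<subseteq> F \<omega>"
    "\<And>\<omega> x a b. x \<in> X \<Longrightarrow> a \<in> G \<omega> \<Longrightarrow> b \<in> G \<omega> \<Longrightarrow> blinfun_apply x a = blinfun_apply x b"
proof -
  have "\<exists>G. support_measurable M G \<and> (\<forall>\<omega>. G \<omega> \<subseteq> F \<omega>) \<and>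
      (\<forall>\<omega>. \<forall>x\<in>X. \<forall>a\<in>G \<omega>. \<forall>b\<in>G \<omega>. blinfun_apply x a = blinfun_apply x b)"
    using assms
  proof (induction X)
    case empty
    then show ?case by auto
  next
    case (insert x X)
    then obtain G where G: "support_measurable M G" "\<forall>\<omega>. G \<omega> \<subseteq> F \<omega>"
      "\<forall>\<omega>. \<forall>x\<in>X. \<forall>a\<in>G \<omega>. \<forall>b\<in>G \<omega>. blinfun_apply x a = blinfun_apply x b"
      by blast
    have "support_measurable M (\<lambda>\<omega>. face x (G \<omega>))"
      using G(1) by (rule support_measurable_face)
    moreover have "\<forall>\<omega>. face x (G \<omega>) \<subseteq> F \<omega>"
      using G(2) face_subset by blast
    moreover have "\<forall>\<omega>. \<forall>z\<in>insert x X. \<forall>a\<in>face x (G \<omega>). \<forall>b\<in>face x (G \<omega>).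
        blinfun_apply z a = blinfun_apply z b"
      using G(3) unfolding face_def by (auto; metis)
    ultimately show ?case
      by blast
  qed
  then show ?thesis
    using that by metis
qed

text \<open>Every point of the face in direction \<open>x\<close> already maximises
  \<open>x\<close>; iterated faces along coordinates then shrink this face measurably to one
  point.\<close>

lemma extremal_selection:
  fixes F :: "'w \<Rightarrow> 'a::{banach, second_countable_topology} set"
  assumes fd: "\<exists>B :: 'a set. finite B \<and> span B = UNIV"
    and Pk: "\<And>\<omega>. \<omega> \<in> space M \<Longrightarrow> F \<omega> \<in> Pk"
    and int: "\<And>x. integrable M (\<lambda>\<omega>. support_fun x (F \<omega>))"
  obtains f where "integrable M f" "\<And>\<omega>. \<omega> \<in> space M \<Longrightarrow> f \<omega> \<in> F \<omega>"
    "\<And>\<omega>. \<omega> \<in> space M \<Longrightarrow> blinfun_apply x (f \<omega>) = support_fun x (F \<omega>)"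
proof -
  obtain B :: "'a set" and e :: "'a \<Rightarrow> 'a \<Rightarrow>\<^sub>L real"
    where B: "finite B" "\<And>y. y = (\<Sum>b\<in>B. blinfun_apply (e b) y *\<^sub>R b)"
    using finite_dim_coordinates[OF fd] by metis
  have "support_measurable M F"
    using Pk int by (auto simp: support_measurable_def)
  then have "support_measurable M (\<lambda>\<omega>. face x (F \<omega>))"
    by (rule support_measurable_face)
  with finite_imageI[OF B(1), of e] obtain G where G: "support_measurable M G"
      "\<And>\<omega>. G \<omega> \<subseteq> face x (F \<omega>)"
      "\<And>\<omega> b a a'. b \<in> B \<Longrightarrow> a \<in> G \<omega> \<Longrightarrow> a' \<in> G \<omega> \<Longrightarrow> blinfun_apply (e b) a = blinfun_apply (e b) a'"
    by (rule support_measurable_iterated_face) blast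
  \<comment> \<open>The choice is harmless: all coordinates are constant on
    \<open>G \<omega>\<close>, so they equal its support functions, which are measurable.\<close>
  define f where "f \<omega> = (SOME a. a \<in> G \<omega>)" for \<omega>
  have fG: "f \<omega> \<in> G \<omega>" if "\<omega> \<in> space M" for \<omega>
    using G(1) that by (auto simp: f_def some_in_eq support_measurable_def Pk_def)
  have fF: "f \<omega> \<in> F \<omega>" "blinfun_apply x (f \<omega>) = support_fun x (F \<omega>)" if "\<omega> \<in> space M" for \<omega>
    using fG[OF that] G(2)[of \<omega>] by (auto simp: face_def)
  have "integrable M (\<lambda>\<omega>. blinfun_apply (e b) (f \<omega>))" if "b \<in> B" for b
  proof (rule Bochner_Integration.integrable_bound)
    \<comment> \<open>A coordinate of a point of \<open>F \<omega>\<close> lies between minus the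
      support function at \<open>- e b\<close> and the support function at
      \<open>e b\<close>.\<close>
    show "integrable M (\<lambda>\<omega>. \<bar>support_fun (e b) (F \<omega>)\<bar> + \<bar>support_fun (- e b) (F \<omega>)\<bar>)"
      using int by (intro Bochner_Integration.integrable_add integrable_abs)
    have "blinfun_apply (e b) (f \<omega>) = support_fun (e b) (G \<omega>)" if "\<omega> \<in> space M" for \<omega>
    proof -
      have "G \<omega> \<in> Pk"
        using G(1) that by (auto simp: support_measurable_def)
      then obtain a where "a \<in> G \<omega>" "blinfun_apply (e b) a = support_fun (e b) (G \<omega>)"
        using support_fun_attained by metis
      then show ?thesis
        using G(3)[OF \<open>b \<in> B\<close>] fG[OF that] by metis
    qed
    then have "(\<lambda>\<omega>. blinfun_apply (e b) (f \<omega>)) \<in> borel_measurable M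
        \<longleftrightarrow> (\<lambda>\<omega>. support_fun (e b) (G \<omega>)) \<in> borel_measurable M"
      by (intro measurable_cong) auto
    then show "(\<lambda>\<omega>. blinfun_apply (e b) (f \<omega>)) \<in> borel_measurable M"
      using G(1) by (auto simp: support_measurable_def)
    show "AE \<omega> in M. norm (blinfun_apply (e b) (f \<omega>))
        \<le> norm (\<bar>support_fun (e b) (F \<omega>)\<bar> + \<bar>support_fun (- e b) (F \<omega>)\<bar>)"
    proof (rule AE_I2)
      fix \<omega> assume w: "\<omega> \<in> space M"
      show "norm (blinfun_apply (e b) (f \<omega>))
        \<le> norm (\<bar>support_fun (e b) (F \<omega>)\<bar> + \<bar>support_fun (- e b) (F \<omega>)\<bar>)"
        using blinfun_le_support_fun[OF Pk[OF w] fF(1)[OF w], of "e b"]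
          blinfun_le_support_fun[OF Pk[OF w] fF(1)[OF w], of "- e b"]
        by (simp add: blinfun.minus_left)
    qed
  qed
  then have "integrable M (\<lambda>\<omega>. \<Sum>b\<in>B. blinfun_apply (e b) (f \<omega>) *\<^sub>R b)"
    by (intro Bochner_Integration.integrable_sum integrable_scaleR_left)
  then have "integrable M f"
    by (subst (asm) B(2)[symmetric])
  then show ?thesis
    using that fF by blast
qed

section \<open>Hausdorff distance and the Aumann integral\<close>

text \<open>The functional belonging to \<open>infdist a B\<close> bounds it by the gap at every
  \<open>b\<close>, so one witness per functional is enough. Witnesses replace suprema because
  Aumann integrals are not shown to lie in \<open>Pk\<close>.\<close>

lemma hausdorff_dist_le_dual:
  fixes A B :: "'a::real_normed_vector set"
  assumes fd: "\<exists>B :: 'a set. finite B \<and> span B = UNIV"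
    and "convex A" "A \<noteq> {}" "convex B" "B \<noteq> {}"
    and AB: "\<And>x a. norm x \<le> 1 \<Longrightarrow> a \<in> A \<Longrightarrow> \<exists>b\<in>B. blinfun_apply x a - blinfun_apply x b \<le> r"
    and BA: "\<And>x b. norm x \<le> 1 \<Longrightarrow> b \<in> B \<Longrightarrow> \<exists>a\<in>A. blinfun_apply x b - blinfun_apply x a \<le> r"
  shows "hausdorff_dist A B \<le> r"
proof -
  have "infdist a B \<le> r" if a: "a \<in> A" for a
  proof (rule dual_norm_attained_infdist[OF fd \<open>convex B\<close> \<open>B \<noteq> {}\<close>, of a])
    fix x :: "'a \<Rightarrow>\<^sub>L real"
    assume "norm x \<le> 1" and x: "\<And>b. b \<in> B \<Longrightarrow> infdist a B \<le> blinfun_apply x a - blinfun_apply x b"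
    then show ?thesis
      using AB[OF _ a, of x] order_trans by blast
  qed
  moreover have "infdist b A \<le> r" if b: "b \<in> B" for b
  proof (rule dual_norm_attained_infdist[OF fd \<open>convex A\<close> \<open>A \<noteq> {}\<close>, of b])
    fix x :: "'a \<Rightarrow>\<^sub>L real"
    assume "norm x \<le> 1" and x: "\<And>a. a \<in> A \<Longrightarrow> infdist b A \<le> blinfun_apply x b - blinfun_apply x a"
    then show ?thesis
      using BA[OF _ b, of x] order_trans by blast
  qed
  ultimately show ?thesis
    unfolding hausdorff_dist_def using assms by (auto intro!: cSUP_least)
qed

lemma convex_aumann_integral:
  fixes F :: "'w \<Rightarrow> 'a::{banach, second_countable_topology} set"
  assumes "\<And>\<omega>. \<omega> \<in> space M \<Longrightarrow> convex (F \<omega>)"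
  shows "convex (aumann_integral M F)"
proof (rule convexI)
  fix a b :: 'a and u v :: real
  assume ab: "a \<in> aumann_integral M F" "b \<in> aumann_integral M F" and uv: "0 \<le> u" "0 \<le> v" "u + v = 1"
  obtain f g where f: "integrable M f" "AE \<omega> in M. f \<omega> \<in> F \<omega>" "a = integral\<^sup>L M f"
    and g: "integrable M g" "AE \<omega> in M. g \<omega> \<in> F \<omega>" "b = integral\<^sup>L M g"
    using ab by (auto simp: aumann_integral_def)
  have "AE \<omega> in M. u *\<^sub>R f \<omega> + v *\<^sub>R g \<omega> \<in> F \<omega>"
    using f(2) g(2) AE_space by eventually_elim (use assms uv in \<open>auto intro: convexD\<close>)
  moreover have "u *\<^sub>R a + v *\<^sub>R b = (\<integral>\<omega>. u *\<^sub>R f \<omega> + v *\<^sub>R g \<omega> \<partial>M)"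
    using f g by simp
  moreover have "integrable M (\<lambda>\<omega>. u *\<^sub>R f \<omega> + v *\<^sub>R g \<omega>)"
    using f g by simp
  ultimately show "u *\<^sub>R a + v *\<^sub>R b \<in> aumann_integral M F"
    unfolding aumann_integral_def by blast
qed

lemma blinfun_aumann_integral_le:
  fixes F :: "'w \<Rightarrow> 'a::{banach, second_countable_topology} set"
  assumes "\<And>\<omega>. \<omega> \<in> space M \<Longrightarrow> F \<omega> \<in> Pk" "integrable M (\<lambda>\<omega>. support_fun x (F \<omega>))"
    and "a \<in> aumann_integral M F"
  shows "blinfun_apply x a \<le> (\<integral>\<omega>. support_fun x (F \<omega>) \<partial>M)"
proof -
  obtain f where f: "integrable M f" "AE \<omega> in M. f \<omega> \<in> F \<omega>" "a = integral\<^sup>L M f"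
    using assms(3) by (auto simp: aumann_integral_def)
  have "blinfun_apply x a = (\<integral>\<omega>. blinfun_apply x (f \<omega>) \<partial>M)"
    unfolding f(3) by (rule integral_bounded_linear[symmetric, OF blinfun.bounded_linear_right f(1)])
  also have "\<dots> \<le> (\<integral>\<omega>. support_fun x (F \<omega>) \<partial>M)"
  proof (rule integral_mono_AE)
    show "integrable M (\<lambda>\<omega>. blinfun_apply x (f \<omega>))"
      by (rule integrable_bounded_linear[OF blinfun.bounded_linear_right f(1)])
    show "AE \<omega> in M. blinfun_apply x (f \<omega>) \<le> support_fun x (F \<omega>)"
      using f(2) AE_space by eventually_elim (use assms(1) blinfun_le_support_fun in blast)
  qed fact
  finally show ?thesis .
qed

text \<open>The integral of an extremal selection is a maximiser, so with the preceding upper bound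
  the expected support function is the support function of the Aumann integral.\<close>

lemma aumann_integral_support_attained:
  fixes F :: "'w \<Rightarrow> 'a::{banach, second_countable_topology} set"
  assumes "\<exists>B :: 'a set. finite B \<and> span B = UNIV"
    and "\<And>\<omega>. \<omega> \<in> space M \<Longrightarrow> F \<omega> \<in> Pk"
    and "\<And>x. integrable M (\<lambda>\<omega>. support_fun x (F \<omega>))"
  obtains a where "a \<in> aumann_integral M F"
    "blinfun_apply x a = (\<integral>\<omega>. support_fun x (F \<omega>) \<partial>M)"
proof -
  obtain f where f: "integrable M f" "\<And>\<omega>. \<omega> \<in> space M \<Longrightarrow> f \<omega> \<in> F \<omega>"
    "\<And>\<omega>. \<omega> \<in> space M \<Longrightarrow> blinfun_apply x (f \<omega>) = support_fun x (F \<omega>)"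
    using extremal_selection[OF assms, where x = x] by metis
  have "blinfun_apply x (integral\<^sup>L M f) = (\<integral>\<omega>. blinfun_apply x (f \<omega>) \<partial>M)"
    by (rule integral_bounded_linear[symmetric, OF blinfun.bounded_linear_right f(1)])
  also have "\<dots> = (\<integral>\<omega>. support_fun x (F \<omega>) \<partial>M)"
    using f(3) by (intro Bochner_Integration.integral_cong) auto
  finally show ?thesis
    using f by (intro that[of "integral\<^sup>L M f"]) (auto simp: aumann_integral_def)
qed

text \<open>Each functional attains its maximum on both averages, at the averaged support function
  and at its expectation. The hypothesis compares these two maxima, which is what the dual bound
  asks for.\<close>

lemma hausdorff_dist_averages_le:
  fixes V :: "nat \<Rightarrow> 'w \<Rightarrow> 'a::{banach, second_countable_topology} set"
  assumes fd: "\<exists>B :: 'a set. finite B \<and> span B = UNIV"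
    and Pkc: "\<And>k \<omega>. \<omega> \<in> space M \<Longrightarrow> V k \<omega> \<in> Pkc"
    and int: "\<And>k x. integrable M (\<lambda>\<omega>. support_fun x (V k \<omega>))"
    and \<omega>: "\<omega> \<in> space M"
    and r: "\<And>x. norm x \<le> 1 \<Longrightarrow> \<bar>1 / real n *
      (\<Sum>k<n. support_fun x (V k \<omega>) - (\<integral>\<omega>. support_fun x (V k \<omega>) \<partial>M))\<bar> \<le> r"
  shows "hausdorff_dist ((*\<^sub>R) (1 / real n) ` (\<Sum>k<n. V k \<omega>))
           ((*\<^sub>R) (1 / real n) ` (\<Sum>k<n. aumann_integral M (V k))) \<le> r"
    (is "hausdorff_dist ?A ?B \<le> r")
proof -
  have Pk: "V k \<omega> \<in> Pk" if "\<omega> \<in> space M" for k \<omega>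
    using Pkc[OF that, of k] by (auto simp: Pk_def Pkc_def)
  have cvx: "convex (V k \<omega>)" if "\<omega> \<in> space M" for k \<omega>
    using Pkc[OF that, of k] by (auto simp: Pkc_def)
  have attainedV: "\<exists>a. a \<in> V k \<omega> \<and> blinfun_apply x a = support_fun x (V k \<omega>)" for k x
    using Pk[OF \<omega>] by (rule support_fun_attained) blast
  have attained: "\<exists>a. a \<in> aumann_integral M (V k) \<and>
      blinfun_apply x a = (\<integral>\<omega>. support_fun x (V k \<omega>) \<partial>M)" for k x
    by (rule aumann_integral_support_attained[OF fd, of M "V k" x]) (auto intro: Pk int)
  \<comment> \<open>A point of a Minkowski sum is a choice of one point per summand, so functionals
    can be maximised summand by summand.\<close>
  have A: "?A = {(1 / real n) *\<^sub>R (\<Sum>k<n. s k) |s. \<forall>k\<in>{..<n}. s k \<in> V k \<omega>}"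
    and B: "?B = {(1 / real n) *\<^sub>R (\<Sum>k<n. s k) |s. \<forall>k\<in>{..<n}. s k \<in> aumann_integral M (V k)}"
    by (auto simp: set_sum_alt)
  have apply_avg: "blinfun_apply x ((1 / real n) *\<^sub>R (\<Sum>k<n. s k)) = 1 / real n * (\<Sum>k<n. blinfun_apply x (s k))"
    for x :: "'a \<Rightarrow>\<^sub>L real" and s
    by (simp add: blinfun.scaleR_right blinfun.sum_right)
  have optA: "\<exists>a\<in>?A. blinfun_apply x a = 1 / real n * (\<Sum>k<n. support_fun x (V k \<omega>))" for x
  proof -
    obtain s :: "nat \<Rightarrow> 'a" where "\<And>k. s k \<in> V k \<omega>" "\<And>k. blinfun_apply x (s k) = support_fun x (V k \<omega>)"
      using attainedV[of _ x] by metis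
    then show ?thesis
      unfolding A by (intro bexI[of _ "(1 / real n) *\<^sub>R (\<Sum>k<n. s k)"]) (auto simp only: apply_avg)
  qed
  have optB: "\<exists>b\<in>?B. blinfun_apply x b = 1 / real n * (\<Sum>k<n. \<integral>\<omega>. support_fun x (V k \<omega>) \<partial>M)" for x
  proof -
    obtain s :: "nat \<Rightarrow> 'a" where "\<And>k. s k \<in> aumann_integral M (V k)"
      "\<And>k. blinfun_apply x (s k) = (\<integral>\<omega>. support_fun x (V k \<omega>) \<partial>M)"
      using attained[of _ x] by metis
    then show ?thesis
      unfolding B by (intro bexI[of _ "(1 / real n) *\<^sub>R (\<Sum>k<n. s k)"]) (auto simp only: apply_avg)
  qed
  have leA: "blinfun_apply x a \<le> 1 / real n * (\<Sum>k<n. support_fun x (V k \<omega>))" if "a \<in> ?A" for a x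
    using that unfolding A
    by (auto simp only: apply_avg intro!: mult_left_mono sum_mono blinfun_le_support_fun[OF Pk[OF \<omega>]]) auto
  have leB: "blinfun_apply x b \<le> 1 / real n * (\<Sum>k<n. \<integral>\<omega>. support_fun x (V k \<omega>) \<partial>M)" if "b \<in> ?B" for b x
    using that unfolding B
    by (auto simp only: apply_avg intro!: mult_left_mono sum_mono blinfun_aumann_integral_le[OF Pk int]) auto
  show ?thesis
  proof (rule hausdorff_dist_le_dual[OF fd])
    show "convex ?A"
      by (intro convex_scaling convex_set_sum cvx \<omega>)
    show "convex ?B"
      by (intro convex_scaling convex_set_sum convex_aumann_integral cvx)
    show "?A \<noteq> {}" "?B \<noteq> {}"
      using optA[of 0] optB[of 0] by blast+
    fix x :: "'a \<Rightarrow>\<^sub>L real" assume x: "norm x \<le> 1"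
    have r': "\<bar>1 / real n * (\<Sum>k<n. support_fun x (V k \<omega>))
        - 1 / real n * (\<Sum>k<n. \<integral>\<omega>. support_fun x (V k \<omega>) \<partial>M)\<bar> \<le> r"
      using r[OF x] by (simp only: sum_subtractf right_diff_distrib)
    show "\<exists>b\<in>?B. blinfun_apply x a - blinfun_apply x b \<le> r" if "a \<in> ?A" for a
    proof -
      obtain b where "b \<in> ?B"
        "blinfun_apply x b = 1 / real n * (\<Sum>k<n. \<integral>\<omega>. support_fun x (V k \<omega>) \<partial>M)"
        using optB by blast
      then show ?thesis
        using leA[OF that, of x] r' by (intro bexI[of _ b]) linarith+
    qed
    show "\<exists>a\<in>?A. blinfun_apply x b - blinfun_apply x a \<le> r" if "b \<in> ?B" for b
    proof -
      obtain a where "a \<in> ?A"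
        "blinfun_apply x a = 1 / real n * (\<Sum>k<n. support_fun x (V k \<omega>))"
        using optA by blast
      then show ?thesis
        using leB[OF that, of x] r' by (intro bexI[of _ a]) linarith+
    qed
  qed
qed

section \<open>Second moments\<close>

text \<open>The norm of a compact set exceeds \<open>r\<close> exactly when the set hits the open
  complement of the closed ball of radius \<open>r\<close>.\<close>

lemma borel_measurable_set_norm:
  fixes F :: "'w \<Rightarrow> 'a::real_normed_vector set"
  assumes "set_valued_rv M F" "\<And>\<omega>. \<omega> \<in> space M \<Longrightarrow> F \<omega> \<in> Pk"
  shows "(\<lambda>\<omega>. set_norm (F \<omega>)) \<in> borel_measurable M"
  unfolding borel_measurable_iff_greater
proof
  fix r
  have "r < set_norm A \<longleftrightarrow> A \<inter> {a. r < norm a} \<noteq> {}" if "A \<in> Pk" for A :: "'a set"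
  proof -
    have "bdd_above (norm ` A)"
      using norm_le_set_norm[OF that] by (intro bdd_aboveI2)
    then show ?thesis
      unfolding set_norm_eq[OF that] using PkD(2)[OF that] by (auto simp: less_cSUP_iff)
  qed
  then have "{\<omega> \<in> space M. r < set_norm (F \<omega>)} = {\<omega> \<in> space M. F \<omega> \<inter> {a. r < norm a} \<noteq> {}}"
    using assms(2) by auto
  moreover have "open {a :: 'a. r < norm a}"
    by (intro open_Collect_less continuous_intros)
  ultimately show "{\<omega> \<in> space M. r < set_norm (F \<omega>)} \<in> sets M"
    using assms(1) by (simp add: set_valued_rv_def)
qed

lemma compactin_Pk_topology_bounded:
  fixes K :: "'a::real_normed_vector set set"
  assumes "compactin Pk_topology K"
  obtains R where "R \<ge> 0" "\<And>A. A \<in> K \<Longrightarrow> set_norm A \<le> R"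
proof -
  interpret Metric_space "Pk :: 'a set set" Pk_dist
    by (rule Metric_space_Pk)
  have "mbounded K"
    using compactin_imp_mbounded assms by (simp add: Pk_topology_def)
  moreover have 0: "{0 :: 'a} \<in> Pk"
    by (simp add: Pk_def)
  \<comment> \<open>With \<open>{0}\<close> included, the bound on mutual distances covers
    \<open>set_norm\<close>, the distance from \<open>{0}\<close>.\<close>
  ultimately have "mbounded (insert {0} K)"
    by (simp add: mbounded_insert)
  then obtain R where K: "\<And>A. A \<in> K \<Longrightarrow> A \<in> Pk" and R: "\<And>A. A \<in> K \<Longrightarrow> Pk_dist {0} A \<le> R"
    unfolding mbounded_alt by blast
  show ?thesis
  proof (rule that[of "max 0 R"])
    fix A assume "A \<in> K"
    then show "set_norm A \<le> max 0 R"
      using R[of A] K[of A] 0 by (simp add: set_norm_def Pk_dist_def le_max_iff_disj)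
  qed simp
qed

context prob_space
begin

text \<open>One compact family, taken for tolerance 1, suffices: on it the norms are at most
  \<open>R\<close>, and off it the second moment contributes less than 1.\<close>

lemma compactly_uniformly_integrable_second_moment:
  fixes V :: "nat \<Rightarrow> 'a \<Rightarrow> 'b::real_normed_vector set"
  assumes ui: "compactly_uniformly_integrable 2 M V"
    and Pk: "\<And>n \<omega>. \<omega> \<in> space M \<Longrightarrow> V n \<omega> \<in> Pk"
    and rv: "\<And>n. set_valued_rv M (V n)"
  obtains C where "\<And>n. integrable M (\<lambda>\<omega>. (set_norm (V n \<omega>))\<^sup>2)"
    "\<And>n. expectation (\<lambda>\<omega>. (set_norm (V n \<omega>))\<^sup>2) \<le> C"
proof -
  obtain K where K: "compactin Pk_topology K"
    "\<And>n. (\<integral>\<^sup>+\<omega>. ennreal (set_norm (V n \<omega>) powr 2) * indicator {\<omega>. V n \<omega> \<notin> K} \<omega> \<partial>M) < ennreal 1"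
    using ui unfolding compactly_uniformly_integrable_def by (metis zero_less_one)
  obtain R where R: "R \<ge> 0" "\<And>A. A \<in> K \<Longrightarrow> set_norm A \<le> R"
    using compactin_Pk_topology_bounded[OF K(1)] by metis
  have meas [measurable]: "(\<lambda>\<omega>. set_norm (V n \<omega>)) \<in> borel_measurable M" for n
    using rv Pk by (intro borel_measurable_set_norm)
  have bound: "(\<integral>\<^sup>+\<omega>. ennreal ((set_norm (V n \<omega>))\<^sup>2) \<partial>M) \<le> ennreal (R\<^sup>2 + 1)" for n
  proof -
    \<comment> \<open>The event of leaving \<open>K\<close> is not known to be measurable; this
      measurable event lies inside it and still captures all norms above \<open>R\<close>.\<close>
    let ?T = "{\<omega> \<in> space M. R < set_norm (V n \<omega>)}"
    have "(\<integral>\<^sup>+\<omega>. ennreal ((set_norm (V n \<omega>))\<^sup>2) \<partial>M)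
        \<le> (\<integral>\<^sup>+\<omega>. ennreal (R\<^sup>2) + ennreal ((set_norm (V n \<omega>))\<^sup>2) * indicator ?T \<omega> \<partial>M)"
    proof (rule nn_integral_mono)
      fix \<omega> assume w: "\<omega> \<in> space M"
      show "ennreal ((set_norm (V n \<omega>))\<^sup>2)
          \<le> ennreal (R\<^sup>2) + ennreal ((set_norm (V n \<omega>))\<^sup>2) * indicator ?T \<omega>"
        using w set_norm_nonneg[OF Pk[OF w, of n]]
        by (cases "R < set_norm (V n \<omega>)")
          (auto simp: power_mono intro!: ennreal_leI)
    qed
    also have "\<dots> = ennreal (R\<^sup>2) + (\<integral>\<^sup>+\<omega>. ennreal ((set_norm (V n \<omega>))\<^sup>2) * indicator ?T \<omega> \<partial>M)"
      by (subst nn_integral_add) (auto simp: emeasure_space_1)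
    also have "(\<integral>\<^sup>+\<omega>. ennreal ((set_norm (V n \<omega>))\<^sup>2) * indicator ?T \<omega> \<partial>M)
        \<le> (\<integral>\<^sup>+\<omega>. ennreal (set_norm (V n \<omega>) powr 2) * indicator {\<omega>. V n \<omega> \<notin> K} \<omega> \<partial>M)"
    proof (rule nn_integral_mono)
      fix \<omega> assume w: "\<omega> \<in> space M"
      show "ennreal ((set_norm (V n \<omega>))\<^sup>2) * indicator ?T \<omega>
          \<le> ennreal (set_norm (V n \<omega>) powr 2) * indicator {\<omega>. V n \<omega> \<notin> K} \<omega>"
        using set_norm_nonneg[OF Pk[OF w, of n]] R(2)[of "V n \<omega>"]
        by (auto simp: indicator_def powr_numeral)
    qed
    also have "\<dots> \<le> ennreal 1"
      using K(2) less_imp_le by blast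
    also have "ennreal (R\<^sup>2) + ennreal 1 = ennreal (R\<^sup>2 + 1)"
      by (simp add: ennreal_plus)
    finally show ?thesis
      by (simp add: add_left_mono)
  qed
  show ?thesis
  proof (rule that[of "R\<^sup>2 + 1"])
    fix n
    show int: "integrable M (\<lambda>\<omega>. (set_norm (V n \<omega>))\<^sup>2)"
      using bound[of n] by (intro integrableI_bounded) (auto intro: le_less_trans)
    have "ennreal (expectation (\<lambda>\<omega>. (set_norm (V n \<omega>))\<^sup>2)) \<le> ennreal (R\<^sup>2 + 1)"
      using bound[of n] by (subst nn_integral_eq_integral[symmetric, OF int]) auto
    then show "expectation (\<lambda>\<omega>. (set_norm (V n \<omega>))\<^sup>2) \<le> R\<^sup>2 + 1"
      by (subst (asm) ennreal_le_iff) auto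
  qed
qed

text \<open>Bienayme's identity: after expanding the square, the mixed terms are vanishing
  covariances. Uncorrelatedness covers mixed products only, so the squares are assumed integrable
  separately.\<close>

lemma second_moment_sum_uncorrelated:
  assumes sq: "\<And>k. integrable M (\<lambda>\<omega>. (X k \<omega>)\<^sup>2)"
    and unc: "\<And>i j. i \<noteq> j \<Longrightarrow> uncorrelated M (X i) (X j)"
    and int: "\<And>k::nat. integrable M (X k)"
  shows "integrable M (\<lambda>\<omega>. (\<Sum>k<n. X k \<omega> - expectation (X k))\<^sup>2)"
    and "expectation (\<lambda>\<omega>. (\<Sum>k<n. X k \<omega> - expectation (X k))\<^sup>2) = (\<Sum>k<n. variance (X k))"
proof -
  define Y where "Y k \<omega> = X k \<omega> - expectation (X k)" for k \<omega>
  have XX: "integrable M (\<lambda>\<omega>. X i \<omega> * X j \<omega>)" for i j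
    using unc[of i j] sq[of i] by (cases "i = j") (auto simp: uncorrelated_def power2_eq_square)
  have YY: "integrable M (\<lambda>\<omega>. Y i \<omega> * Y j \<omega>)" for i j
    unfolding Y_def left_diff_distrib right_diff_distrib
    by (intro Bochner_Integration.integrable_diff XX integrable_mult_right integrable_mult_left int) auto
  have "expectation (\<lambda>\<omega>. Y i \<omega> * Y j \<omega>) = (if i = j then variance (X i) else 0)" for i j
    using unc[of i j] by (auto simp: uncorrelated_def cov_def Y_def power2_eq_square)
  then have "expectation (\<lambda>\<omega>. \<Sum>i<n. \<Sum>j<n. Y i \<omega> * Y j \<omega>) = (\<Sum>i<n. \<Sum>j<n. if i = j then variance (X i) else 0)"
    using YY by (simp add: Bochner_Integration.integral_sum)
  moreover have eq: "(\<Sum>k<n. X k \<omega> - expectation (X k))\<^sup>2 = (\<Sum>i<n. \<Sum>j<n. Y i \<omega> * Y j \<omega>)" for \<omega>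
    by (simp add: Y_def power2_eq_square sum_product)
  ultimately show "expectation (\<lambda>\<omega>. (\<Sum>k<n. X k \<omega> - expectation (X k))\<^sup>2) = (\<Sum>k<n. variance (X k))"
    by simp
  show "integrable M (\<lambda>\<omega>. (\<Sum>k<n. X k \<omega> - expectation (X k))\<^sup>2)"
    unfolding eq using YY by simp
qed

text \<open>This is the nonnegativity of the variance of the absolute value.\<close>

lemma expectation_abs_le_sqrt:
  fixes X :: "'a \<Rightarrow> real"
  assumes "integrable M X" "integrable M (\<lambda>\<omega>. (X \<omega>)\<^sup>2)"
  shows "expectation (\<lambda>\<omega>. \<bar>X \<omega>\<bar>) \<le> sqrt (expectation (\<lambda>\<omega>. (X \<omega>)\<^sup>2))"
  using variance_positive[of "\<lambda>\<omega>. \<bar>X \<omega>\<bar>"] variance_eq[of "\<lambda>\<omega>. \<bar>X \<omega>\<bar>"] assms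
  by (intro real_le_rsqrt) auto

end

section \<open>The weak law\<close>

theorem theorem3p3:
  fixes M :: "'w measure"
    and V :: "nat \<Rightarrow> 'w \<Rightarrow> 'a::{banach, second_countable_topology} set"
  assumes "prob_space M" and "complete_measure M" and "nonatomic M"
    and findim: "\<exists>B :: 'a set. finite B \<and> span B = UNIV"
    and rv: "\<And>n. Pkc_valued_rv M (V n)"
    and uncorr: "uncorrelated_seq M V"
    and ui: "compactly_uniformly_integrable 2 M V"
    and var: "\<And>x :: 'a \<Rightarrow>\<^sub>L real. norm x = 1 \<Longrightarrow>
      (\<lambda>n. 1 / (real n)\<^sup>2 * (\<Sum>k<n. prob_space.variance M (\<lambda>\<omega>. support_fun x (V k \<omega>))))
        \<longlonglongrightarrow> 0"
    and "\<epsilon> > 0"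
  shows "(\<lambda>n. measure M {\<omega>\<in>space M.
            hausdorff_dist ((*\<^sub>R) (1 / real n) ` (\<Sum>k<n. V k \<omega>))
                           ((*\<^sub>R) (1 / real n) ` (\<Sum>k<n. aumann_integral M (V k))) > \<epsilon>})
         \<longlonglongrightarrow> 0"
proof -
  interpret prob_space M by fact
  have Pkc: "V n \<omega> \<in> Pkc" if "\<omega> \<in> space M" for n \<omega>
    using rv[of n] that by (auto simp: Pkc_valued_rv_def)
  have Pk: "V n \<omega> \<in> Pk" if "\<omega> \<in> space M" for n \<omega>
    using Pkc[OF that, of n] by (auto simp: Pk_def Pkc_def)
  have svr: "set_valued_rv M (V n)" for n
    using rv[of n] by (simp add: Pkc_valued_rv_def)
  have [measurable]: "(\<lambda>\<omega>. set_norm (V n \<omega>)) \<in> borel_measurable M" for n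
    using svr Pk by (intro borel_measurable_set_norm)
  have unc: "uncorrelated M (\<lambda>\<omega>. support_fun x (V i \<omega>)) (\<lambda>\<omega>. support_fun x (V j \<omega>))"
    if "i \<noteq> j" for x i j
    using uncorr that by (simp add: uncorrelated_seq_def)
  \<comment> \<open>Integrability is part of \<open>uncorrelated\<close>; any second index serves,
    here \<open>Suc k\<close>.\<close>
  have int: "integrable M (\<lambda>\<omega>. support_fun x (V k \<omega>))" for x k
    using unc[of k "Suc k" x] by (simp add: uncorrelated_def)
  have meas [measurable]: "(\<lambda>\<omega>. support_fun x (V k \<omega>)) \<in> borel_measurable M" for x k
    using int by (rule borel_measurable_integrable)
  obtain C0 where nsq: "\<And>n. integrable M (\<lambda>\<omega>. (set_norm (V n \<omega>))\<^sup>2)"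
    "\<And>n. expectation (\<lambda>\<omega>. (set_norm (V n \<omega>))\<^sup>2) \<le> C0"
    using compactly_uniformly_integrable_second_moment[OF ui Pk svr] by metis
  \<comment> \<open>By \<open>t \<le> 1 + t\<^sup>2\<close> this bounds all first moments of the
    norms; it is also positive, so it may stand in a denominator later.\<close>
  define C where "C = 1 + C0"
  have le_sq: "t \<le> 1 + t\<^sup>2" if "t \<ge> 0" for t :: real
    using sum_power2_ge_zero[of "t - 1" 0] that by (simp add: power2_diff)
  have nint: "integrable M (\<lambda>\<omega>. set_norm (V n \<omega>))" for n
    using nsq(1) by (rule square_integrable_imp_integrable[rotated]) simp
  have nexp: "expectation (\<lambda>\<omega>. set_norm (V n \<omega>)) \<le> C" for n
  proof -
    have "expectation (\<lambda>\<omega>. set_norm (V n \<omega>)) \<le> expectation (\<lambda>\<omega>. 1 + (set_norm (V n \<omega>))\<^sup>2)"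
      using nsq(1) nint set_norm_nonneg[OF Pk] by (intro integral_mono le_sq) auto
    also have "\<dots> \<le> C"
      using nsq[of n] by (simp add: C_def prob_space)
    finally show ?thesis .
  qed
  have "C0 \<ge> 0"
    by (rule order_trans[OF integral_nonneg_AE nsq(2)[of 0]]) simp
  then have C_pos: "C > 0"
    by (simp add: C_def)
  have sq: "integrable M (\<lambda>\<omega>. (support_fun x (V k \<omega>))\<^sup>2)" for x k
  proof (rule Bochner_Integration.integrable_bound)
    show "integrable M (\<lambda>\<omega>. (norm x)\<^sup>2 * (set_norm (V k \<omega>))\<^sup>2)"
      using nsq(1) by simp
    show "AE \<omega> in M. norm ((support_fun x (V k \<omega>))\<^sup>2) \<le> norm ((norm x)\<^sup>2 * (set_norm (V k \<omega>))\<^sup>2)"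
    proof (rule AE_I2)
      fix \<omega> assume w: "\<omega> \<in> space M"
      have "\<bar>support_fun x (V k \<omega>)\<bar> \<le> norm x * set_norm (V k \<omega>)"
        using support_fun_diff_le[OF Pk[OF w], of x k 0] support_fun_zero[OF Pk[OF w]] by simp
      then have "\<bar>support_fun x (V k \<omega>)\<bar>\<^sup>2 \<le> (norm x * set_norm (V k \<omega>))\<^sup>2"
        by (intro power_mono) auto
      then show "norm ((support_fun x (V k \<omega>))\<^sup>2) \<le> norm ((norm x)\<^sup>2 * (set_norm (V k \<omega>))\<^sup>2)"
        by (simp add: power_mult_distrib)
    qed
  qed measurable
  \<comment> \<open>The variance is homogeneous of degree 2 in the functional, which extends the
    hypothesis from the unit sphere; the zero functional cannot be normalised but has variance
    0.\<close>
  have var0: "(\<lambda>n. 1 / (real n)\<^sup>2 * (\<Sum>k<n. variance (\<lambda>\<omega>. support_fun x (V k \<omega>)))) \<longlonglongrightarrow> 0"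
    (is "(\<lambda>n. ?v x n) \<longlonglongrightarrow> 0") for x
  proof (cases "x = 0")
    case True
    have "expectation (\<lambda>\<omega>. support_fun 0 (V k \<omega>)) = expectation (\<lambda>\<omega>. 0)" for k
      using support_fun_zero[OF Pk] by (intro Bochner_Integration.integral_cong) auto
    then have "variance (\<lambda>\<omega>. support_fun 0 (V k \<omega>)) = expectation (\<lambda>\<omega>. 0)" for k
      using support_fun_zero[OF Pk] by (intro Bochner_Integration.integral_cong) auto
    then show ?thesis
      using True by simp
  next
    case False
    define u where "u = (1 / norm x) *\<^sub>R x"
    have x: "x = norm x *\<^sub>R u" and u: "norm u = 1"
      using False by (auto simp: u_def)
    have scale: "support_fun x (V k \<omega>) = norm x * support_fun u (V k \<omega>)" if "\<omega> \<in> space M" for k \<omega>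
      using support_fun_scaleR[OF Pk[OF that], of "norm x" u k] x by simp
    have "expectation (\<lambda>\<omega>. support_fun x (V k \<omega>)) = expectation (\<lambda>\<omega>. norm x * support_fun u (V k \<omega>))" for k
      using scale by (intro Bochner_Integration.integral_cong) auto
    then have "variance (\<lambda>\<omega>. support_fun x (V k \<omega>))
        = expectation (\<lambda>\<omega>. (norm x)\<^sup>2 * (support_fun u (V k \<omega>) - expectation (\<lambda>\<omega>. support_fun u (V k \<omega>)))\<^sup>2)" for k
      using scale
      by (intro Bochner_Integration.integral_cong)
        (auto simp: right_diff_distrib[symmetric] power_mult_distrib)
    then have eq: "?v x n = (norm x)\<^sup>2 * ?v u n" for n
      by (simp add: sum_distrib_left mult_ac)
    show ?thesis
      unfolding eq using var[OF u] by (rule tendsto_mult_right_zero)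
  qed
  define D where "D n x \<omega> = 1 / real n *
    (\<Sum>k<n. support_fun x (V k \<omega>) - expectation (\<lambda>\<omega>. support_fun x (V k \<omega>)))" for n x \<omega>
  have D_int: "integrable M (D n x)" for n x
    unfolding D_def using int by auto
  \<comment> \<open>A bound in mean, unlike a tail bound, can be summed over the net before Markov's
    inequality is applied.\<close>
  have D_exp: "expectation (\<lambda>\<omega>. \<bar>D n x \<omega>\<bar>) \<le> sqrt (?v x n)" for n x
  proof -
    note m2 = second_moment_sum_uncorrelated[where X = "\<lambda>k \<omega>. support_fun x (V k \<omega>)", OF sq unc int]
    have "(\<lambda>\<omega>. (D n x \<omega>)\<^sup>2) = (\<lambda>\<omega>. 1 / (real n)\<^sup>2 *
        (\<Sum>k<n. support_fun x (V k \<omega>) - expectation (\<lambda>\<omega>. support_fun x (V k \<omega>)))\<^sup>2)"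
      by (simp add: D_def power_mult_distrib power_divide)
    then have "integrable M (\<lambda>\<omega>. (D n x \<omega>)\<^sup>2)" "expectation (\<lambda>\<omega>. (D n x \<omega>)\<^sup>2) = ?v x n"
      using m2[of n] by simp_all
    then show ?thesis
      using expectation_abs_le_sqrt[OF D_int, of n x] by simp
  qed
  \<comment> \<open>The Lipschitz constant is random: the norms come from the support functions, and
    \<open>C\<close> comes from their expectations.\<close>
  have D_lip: "\<bar>D n x \<omega>\<bar> \<le> \<bar>D n z \<omega>\<bar> + norm (x - z) * (1 / real n * (\<Sum>k<n. set_norm (V k \<omega>) + C))"
    if w: "\<omega> \<in> space M" for n x z \<omega>
  proof -
    let ?E = "\<lambda>x k. expectation (\<lambda>\<omega>. support_fun x (V k \<omega>))"
    have E: "\<bar>?E x k - ?E z k\<bar> \<le> norm (x - z) * C" for k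
    proof -
      have "\<bar>?E x k - ?E z k\<bar> = \<bar>expectation (\<lambda>\<omega>. support_fun x (V k \<omega>) - support_fun z (V k \<omega>))\<bar>"
        using int by simp
      also have "\<dots> \<le> expectation (\<lambda>\<omega>. \<bar>support_fun x (V k \<omega>) - support_fun z (V k \<omega>)\<bar>)"
        by (rule integral_abs_bound)
      also have "\<dots> \<le> expectation (\<lambda>\<omega>. norm (x - z) * set_norm (V k \<omega>))"
        using int nint support_fun_diff_le[OF Pk] by (intro integral_mono) auto
      also have "\<dots> \<le> norm (x - z) * C"
        using nexp[of k] by (simp add: mult_left_mono)
      finally show ?thesis .
    qed
    have "D n x \<omega> - D n z \<omega> = 1 / real n * (\<Sum>k<n. (support_fun x (V k \<omega>) - support_fun z (V k \<omega>)) - (?E x k - ?E z k))"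
      by (simp add: D_def sum_subtractf diff_divide_distrib)
    also have "\<bar>\<dots>\<bar> \<le> 1 / real n * (\<Sum>k<n. norm (x - z) * (set_norm (V k \<omega>) + C))"
    proof -
      have "\<bar>(support_fun x (V k \<omega>) - support_fun z (V k \<omega>)) - (?E x k - ?E z k)\<bar>
          \<le> norm (x - z) * (set_norm (V k \<omega>) + C)" for k
        using support_fun_diff_le[OF Pk[OF w], of x k z] E[of k] by (simp add: distrib_left)
      then show ?thesis
        unfolding abs_mult
        by (intro mult_mono order_trans[OF sum_abs] sum_mono) (auto intro: sum_nonneg)
    qed
    also have "\<dots> = norm (x - z) * (1 / real n * (\<Sum>k<n. set_norm (V k \<omega>) + C))"
      by (simp add: sum_distrib_left mult_ac)
    finally show ?thesis
      by linarith
  qed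
  let ?P = "\<lambda>n. {\<omega>\<in>space M. hausdorff_dist ((*\<^sub>R) (1 / real n) ` (\<Sum>k<n. V k \<omega>))
      ((*\<^sub>R) (1 / real n) ` (\<Sum>k<n. aumann_integral M (V k))) > \<epsilon>}"
  have prob_bound: "measure M (?P n) \<le> ((\<Sum>z\<in>N. sqrt (?v z n)) + \<delta> * (2 * C)) / \<epsilon>"
    if N: "finite N" "\<And>x. norm x \<le> 1 \<Longrightarrow> \<exists>z\<in>N. norm (x - z) \<le> \<delta>" and "\<delta> > 0" for N \<delta> n
  proof -
    \<comment> \<open>An integrable majorant of the Hausdorff distance: the deviations on the net
      plus the Lipschitz error for mesh \<open>\<delta>\<close>.\<close>
    define Z where "Z \<omega> = (\<Sum>z\<in>N. \<bar>D n z \<omega>\<bar>) + \<delta> * (1 / real n * (\<Sum>k<n. set_norm (V k \<omega>) + C))" for \<omega>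
    have norms_nonneg: "0 \<le> 1 / real n * (\<Sum>k<n. set_norm (V k \<omega>) + C)" if "\<omega> \<in> space M" for \<omega>
      using set_norm_nonneg[OF Pk[OF that]] C_pos
      by (intro mult_nonneg_nonneg sum_nonneg add_nonneg_nonneg) (auto simp: less_imp_le)
    have Z_int: "integrable M Z"
      unfolding Z_def using D_int nint by auto
    have "?P n \<subseteq> {\<omega>\<in>space M. Z \<omega> \<ge> \<epsilon>}"
    proof clarify
      fix \<omega> assume w: "\<omega> \<in> space M"
      assume "\<epsilon> < hausdorff_dist ((*\<^sub>R) (1 / real n) ` (\<Sum>k<n. V k \<omega>))
        ((*\<^sub>R) (1 / real n) ` (\<Sum>k<n. aumann_integral M (V k)))"
      also have "\<dots> \<le> Z \<omega>"
      proof (rule hausdorff_dist_averages_le[OF findim Pkc int w])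
        fix x :: "'a \<Rightarrow>\<^sub>L real" assume "norm x \<le> 1"
        then obtain z where z: "z \<in> N" "norm (x - z) \<le> \<delta>"
          using N(2) by blast
        have "\<bar>D n z \<omega>\<bar> \<le> (\<Sum>z\<in>N. \<bar>D n z \<omega>\<bar>)"
          using N(1) z(1) by (intro member_le_sum) auto
        moreover have "norm (x - z) * (1 / real n * (\<Sum>k<n. set_norm (V k \<omega>) + C))
            \<le> \<delta> * (1 / real n * (\<Sum>k<n. set_norm (V k \<omega>) + C))"
          using z(2) norms_nonneg[OF w] by (rule mult_right_mono)
        ultimately have "\<bar>D n x \<omega>\<bar> \<le> Z \<omega>"
          using D_lip[OF w, of n x z] by (simp add: Z_def)
        then show "\<bar>1 / real n * (\<Sum>k<n. support_fun x (V k \<omega>)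
            - expectation (\<lambda>\<omega>. support_fun x (V k \<omega>)))\<bar> \<le> Z \<omega>"
          by (simp add: D_def)
      qed
      finally show "\<epsilon> \<le> Z \<omega>" by simp
    qed
    \<comment> \<open>Monotonicity asks for measurability of the larger event only, since
      \<open>measure\<close> is 0 on sets outside \<open>sets M\<close>.\<close>
    then have "measure M (?P n) \<le> measure M {\<omega>\<in>space M. Z \<omega> \<ge> \<epsilon>}"
      using borel_measurable_integrable[OF Z_int] by (intro finite_measure_mono) auto
    also have "\<dots> \<le> expectation Z / \<epsilon>"
    proof (rule integral_Markov_inequality_measure[OF Z_int, of "{}"])
      show "AE \<omega> in M. 0 \<le> Z \<omega>"
        using norms_nonneg \<open>\<delta> > 0\<close> unfolding Z_def
        by (intro AE_I2 add_nonneg_nonneg sum_nonneg mult_nonneg_nonneg[of \<delta>]) auto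
    qed (use \<open>\<epsilon> > 0\<close> in auto)
    also have "expectation Z \<le> (\<Sum>z\<in>N. sqrt (?v z n)) + \<delta> * (2 * C)"
    proof -
      have "expectation Z = (\<Sum>z\<in>N. expectation (\<lambda>\<omega>. \<bar>D n z \<omega>\<bar>))
          + \<delta> * (1 / real n * (\<Sum>k<n. expectation (\<lambda>\<omega>. set_norm (V k \<omega>)) + C))"
        unfolding Z_def using D_int nint by (simp add: prob_space)
      \<comment> \<open>One \<open>C\<close> bounds the mean norm, the other is the constant in the
        Lipschitz bound; for \<open>n = 0\<close> the left side is 0 because
        \<open>1 / 0 = 0\<close>.\<close>
      also have "1 / real n * (\<Sum>k<n. expectation (\<lambda>\<omega>. set_norm (V k \<omega>)) + C) \<le> 2 * C"
      proof -
        have "(\<Sum>k<n. expectation (\<lambda>\<omega>. set_norm (V k \<omega>)) + C) \<le> (\<Sum>k<n. 2 * C)"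
          using nexp by (intro sum_mono) simp
        then show ?thesis
          using C_pos by (cases "n = 0") (auto simp: field_simps)
      qed
      finally show ?thesis
        using D_exp \<open>\<delta> > 0\<close> by (meson add_mono mult_left_mono order_trans sum_mono less_imp_le order_refl)
    qed
    finally show ?thesis
      using \<open>\<epsilon> > 0\<close> by (simp add: divide_right_mono)
  qed
  show ?thesis
  proof (rule order_tendstoI)
    fix e :: real assume "0 < e"
    \<comment> \<open>The mesh is chosen so that the Lipschitz error uses up exactly half of
      \<open>e\<close>.\<close>
    define \<delta> where "\<delta> = \<epsilon> * e / (4 * C)"
    have \<delta>: "\<delta> > 0" "\<delta> * (2 * C) / \<epsilon> = e / 2"
      using \<open>0 < e\<close> \<open>\<epsilon> > 0\<close> C_pos by (auto simp: \<delta>_def)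
    obtain N :: "('a \<Rightarrow>\<^sub>L real) set" where N: "finite N" "\<And>x. norm x \<le> 1 \<Longrightarrow> \<exists>z\<in>N. norm (x - z) \<le> \<delta>"
      using finite_dual_net[OF findim \<delta>(1)] by metis
    have "(\<lambda>n. \<Sum>z\<in>N. sqrt (?v z n)) \<longlonglongrightarrow> (\<Sum>z\<in>N. sqrt 0)"
      by (intro tendsto_sum tendsto_real_sqrt var0)
    then have "\<forall>\<^sub>F n in sequentially. (\<Sum>z\<in>N. sqrt (?v z n)) < \<epsilon> * e / 2"
      using \<open>0 < e\<close> \<open>\<epsilon> > 0\<close> by (intro order_tendstoD) auto
    then show "\<forall>\<^sub>F n in sequentially. measure M (?P n) < e"
    proof eventually_elim
      case (elim n)
      have "measure M (?P n) \<le> (\<Sum>z\<in>N. sqrt (?v z n)) / \<epsilon> + \<delta> * (2 * C) / \<epsilon>"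
        using prob_bound[OF N \<delta>(1), of n] by (simp add: add_divide_distrib)
      also have "\<dots> < e"
        using elim \<open>\<epsilon> > 0\<close> unfolding \<delta>(2) by (simp add: field_simps)
      finally show ?case .
    qed
  qed (auto intro!: always_eventually less_le_trans[OF _ measure_nonneg])
qed

end
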